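(* Consider the interconnected system $$\dot x_1 = f_1(x_1,x_2,u_1),\qquad \dot x_2 = f_2(x_1,x_2,u_2),$$ where $x_i\in\mathbb{R}^{n_i}$, the inputs $u_i:\mathbb{R}_{\ge0}\to\mathbb{R}^{m_i}$ are measurable and essentially bounded, and $f_i:\mathbb{R}^{n_1}\times\mathbb{R}^{n_2}\times\mathbb{R}^{m_i}\to\mathbb{R}^{n_i}$ are continuous with $f_1(0,0,0)=0$ and $f_2(0,0,0)=0$. Suppose that for each $i\in\{1,2\}$, with $j=3-i$, there is a locally Lipschitz function $V_i:\mathbb{R}^{n_i}\to\mathbb{R}_{\ge0}$ such that: (1) there exist $\underline{\alpha}_i,\overline{\alpha}_i\in\mathcal{K}_\infty$ with $\underline{\alpha}_i(|x_i|)\le V_i(x_i)\le\overline{\alpha}_i(|x_i|)$ for all $x_i\in\mathbb{R}^{n_i}$; (2) there exist $\chi_i,\gamma_i\in\mathcal{K}_\infty$ and $\Psi_i\in\mathcal{K}_{\mathrm{FxT}}$ such that for all $x_i\in\mathbb{R}^{n_i}$, $x_j\in\mathbb{R}^{n_j}$, $u_i\in\mathbb{R}^{m_i}$, $$V_i(x_i)\ge\max\{\gamma_i(V_j(x_j)),\chi_i(|u_i|)\}\implies DV_i\big(x_i;f_i(x_1,x_2,u_i)\big)\le-\Psi_i(V_i(x_i)).$$ Suppose further that for each $i=1,2$ there exists $\hat\gamma_i\in\mathcal{K}^{\mathcal{P}}\cup\mathcal{K}^{\mathcal{P}^{-1}}$ with $\hat\gamma_i(s)>\gamma_i(s)$ for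 all $s>0$, and that the small-gain condition $\hat\gamma_1\circ\hat\gamma_2(s)<s$ holds for all $s>0$. Then the origin of the interconnected system (with state $(x_1,x_2)$ and input $(u_1,u_2)$) is fixed-time input-to-state stable (FxT-ISS).
   Context: Comparison functions: $\mathcal{K}$ is the set of continuous strictly increasing $\alpha:\mathbb{R}_{\ge0}\to\mathbb{R}_{\ge0}$ with $\alpha(0)=0$; $\mathcal{K}_\infty$ is the set of $\alpha\in\mathcal{K}$ with $\alpha(s)\to\infty$ as $s\to\infty$. $\mathcal{K}^{\mathcal{P}}$ is the set of $\alpha\in\mathcal{K}_\infty$ of the form $\alpha(s)=\sum_{i=1}^n c_is^{p_i}$ for some $n$, some real $c_i\neq0$ and $p_i>0$, with $\alpha'(s)>0$ for all $s>0$. $\mathcal{K}_{\mathrm{FxT}}$ is the set of $\alpha\in\mathcal{K}^{\mathcal{P}}$ of the form $\alpha(s)=c_1s^{p_1}+c_2s^{p_2}$ with $c_1,c_2>0$, $p_1\in(0,1)$, $p_2>1$. $\mathcal{K}^{\mathcal{P}^{-1}}$ is the set of $\alpha\in\mathcal{K}_\infty$ whose inverse $\alpha^{-1}$ belongs to $\mathcal{K}^{\mathcal{P}}$. A continuous $\beta:\mathbb{R}_{\ge0}\times\mathbb{R}_{\ge0}\to\mathbb{R}_{\ge0}$ is of class $\mathcal{KL}_{\mathrm{FxT}}$ if $\beta(\cdot,0)\in\mathcal{K}$, for each $r\ge0$ the map $\beta(r,\cdot)$ is continuous and non-increasing, and there is a continuous, uniformly bounded $T:\mathbb{R}_{\ge0}\to\mathbb{R}_{\ge0}$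 with $T(0)=0$ and $\beta(r,t)=0$ for all $t\ge T(r)$. For a continuous $V$, the directional Dini derivative is $DV(x;v)=\limsup_{h\to0^+}\frac{V(x+hv)-V(x)}{h}$. For a system $\dot x=f(x,u)$ with $f$ continuous and $f(0,0)=0$, the origin is FxT-ISS if there exist $\beta\in\mathcal{KL}_{\mathrm{FxT}}$ and $\varrho\in\mathcal{K}$ such that for every initial condition $x_0$ and every measurable essentially bounded input $u$, every solution is defined for all $t\ge0$ and satisfies $|x(t)|\le\beta(|x_0|,t)+\varrho(|u|_\infty)$ for all $t\ge0$, where $|u|_\infty=\operatorname{ess\,sup}_{t\ge0}|u(t)|$ and $|\cdot|$ is the Euclidean norm. *)

theory Defs
  imports "HOL-Analysis.Analysis" "HOL-Probability.Probability"
begin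

definition class_K :: "(real \<Rightarrow> real) \<Rightarrow> bool" where
  "class_K \<alpha> \<longleftrightarrow> continuous_on {0..} \<alpha> \<and> strict_mono_on {0..} \<alpha> \<and> \<alpha> 0 = 0
     \<and> (\<forall>s\<ge>0. \<alpha> s \<ge> 0)"

definition class_Kinf :: "(real \<Rightarrow> real) \<Rightarrow> bool" where
  "class_Kinf \<alpha> \<longleftrightarrow> class_K \<alpha> \<and> filterlim \<alpha> at_top at_top"

definition class_KP :: "(real \<Rightarrow> real) \<Rightarrow> bool" where
  "class_KP \<alpha> \<longleftrightarrow> class_Kinf \<alpha> \<and>
     (\<exists>n::nat. \<exists>c p :: nat \<Rightarrow> real. (\<forall>i<n. c i \<noteq> 0 \<and> p i > 0) \<and>
        (\<forall>s\<ge>0. \<alpha> s = (\<Sum>i<n. c i * s powr p i))) \<and>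
     (\<forall>s>0. deriv \<alpha> s > 0)"

definition class_KFxT :: "(real \<Rightarrow> real) \<Rightarrow> bool" where
  "class_KFxT \<alpha> \<longleftrightarrow> class_KP \<alpha> \<and>
     (\<exists>c1 c2 p1 p2 :: real. c1 > 0 \<and> c2 > 0 \<and> 0 < p1 \<and> p1 < 1 \<and> p2 > 1 \<and>
        (\<forall>s\<ge>0. \<alpha> s = c1 * s powr p1 + c2 * s powr p2))"

definition class_KPinv :: "(real \<Rightarrow> real) \<Rightarrow> bool" where
  "class_KPinv \<alpha> \<longleftrightarrow> class_Kinf \<alpha> \<and>
     (\<exists>\<beta>. class_KP \<beta> \<and> (\<forall>s\<ge>0. \<beta> (\<alpha> s) = s \<and> \<alpha> (\<beta> s) = s))"

definition class_KL_FxT :: "(real \<Rightarrow> real \<Rightarrow> real) \<Rightarrow> bool" where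
  "class_KL_FxT \<beta> \<longleftrightarrow>
     continuous_on ({0..} \<times> {0..}) (\<lambda>(r,t). \<beta> r t) \<and>
     (\<forall>r\<ge>0. \<forall>t\<ge>0. \<beta> r t \<ge> 0) \<and>
     class_K (\<lambda>r. \<beta> r 0) \<and>
     (\<forall>r\<ge>0. continuous_on {0..} (\<beta> r) \<and> antimono_on {0..} (\<beta> r)) \<and>
     (\<exists>T :: real \<Rightarrow> real. continuous_on {0..} T \<and> bounded (T ` {0..}) \<and>
        (\<forall>r\<ge>0. T r \<ge> 0) \<and> T 0 = 0 \<and>
        (\<forall>r\<ge>0. \<forall>t\<ge>T r. \<beta> r t = 0))"

definition locally_lipschitz :: "('a::metric_space \<Rightarrow> real) \<Rightarrow> bool" where
  "locally_lipschitz V \<longleftrightarrow>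
     (\<forall>x. \<exists>r>0. \<exists>L. \<forall>y\<in>ball x r. \<forall>z\<in>ball x r. \<bar>V y - V z\<bar> \<le> L * dist y z)"

definition dini_deriv :: "('a::real_normed_vector \<Rightarrow> real) \<Rightarrow> 'a \<Rightarrow> 'a \<Rightarrow> ereal" where
  "dini_deriv V x v = Limsup (at_right 0) (\<lambda>h. ereal ((V (x + h *\<^sub>R v) - V x) / h))"

definition input_measure :: "real measure" where
  "input_measure = restrict_space lebesgue {0..}"

definition admissible_input :: "(real \<Rightarrow> 'b::euclidean_space) \<Rightarrow> bool" where
  "admissible_input u \<longleftrightarrow> u \<in> borel_measurable input_measure \<and>
     esssup input_measure (\<lambda>t. ereal (norm (u t))) < \<infinity>"

definition linf_norm :: "(real \<Rightarrow> 'b::euclidean_space) \<Rightarrow> real" where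
  "linf_norm u = real_of_ereal (esssup input_measure (\<lambda>t. ereal (norm (u t))))"

text \<open>Caratheodory solution of x' = f(x,u(t)) on an interval I containing 0 (I \<subseteq> [0,inf)):
  x(t) = x(0) + int_0^t f(x(s),u(s)) ds for all t in I.\<close>
definition is_solution ::
  "('a::euclidean_space \<Rightarrow> 'b \<Rightarrow> 'a) \<Rightarrow> (real \<Rightarrow> 'b) \<Rightarrow> 'a \<Rightarrow> real set \<Rightarrow> (real \<Rightarrow> 'a) \<Rightarrow> bool" where
  "is_solution f u x0 I x \<longleftrightarrow> x 0 = x0 \<and>
     (\<forall>t\<in>I. (\<lambda>s. f (x s) (u s)) absolutely_integrable_on {0..t} \<and>
             x t = x0 + integral {0..t} (\<lambda>s. f (x s) (u s)))"

text \<open>Fixed-time input-to-state stability of the origin of x' = f(x,u).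
  "Every solution is defined for all t >= 0" is rendered as: every solution on a bounded
  interval [0,T) is the restriction of a solution on [0,inf).\<close>
definition FxT_ISS :: "('a::euclidean_space \<Rightarrow> 'b::euclidean_space \<Rightarrow> 'a) \<Rightarrow> bool" where
  "FxT_ISS f \<longleftrightarrow>
     (\<exists>\<beta> \<rho>. class_KL_FxT \<beta> \<and> class_K \<rho> \<and>
       (\<forall>x0 u. admissible_input u \<longrightarrow>
          (\<forall>T x. T > 0 \<and> is_solution f u x0 {0..<T} x \<longrightarrow>
             (\<exists>y. is_solution f u x0 {0..} y \<and> (\<forall>t\<in>{0..<T}. y t = x t))) \<and>
          (\<forall>x. is_solution f u x0 {0..} x \<longrightarrow>
             (\<forall>t\<ge>0. norm (x t) \<le> \<beta> (norm x0) t + \<rho> (linf_norm u)))))"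

end

theory Submission
  imports Defs "HOL-Complex_Analysis.Great_Picard"
begin

text \<open>Let \<open>\<sigma> = ghat1\<close> and \<open>W = max (V1, \<sigma>(V2))\<close>. Each \<open>\<Psi>\<^sub>i\<close> has a bounded settling function
  \<open>\<theta>\<^sub>i\<close> of class K with \<open>\<theta>\<^sub>i' \<Psi>\<^sub>i \<ge> 1\<close>, so \<open>\<theta>\<^sub>i(V\<^sub>i)\<close> decreases at rate at least 1 wherever the
  implication for \<open>V\<^sub>i\<close> applies. Put \<open>A(w) = \<theta>\<^sub>1(w) + \<theta>\<^sub>2(\<sigma>\<inverse>(w))\<close>. If \<open>V1\<close> dominates, the first
  summand of \<open>A(W)\<close> decreases at rate 1 and the second one by monotonicity; if \<open>\<sigma>(V2)\<close>
  dominates, the roles are exchanged because \<open>A(\<sigma>(v)) = \<theta>\<^sub>1(\<sigma>(v)) + \<theta>\<^sub>2(v)\<close>. Where \<open>V1 = \<sigma>(V2)\<close>,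
  the strict small-gain inequalities make both implications applicable nearby. Hence
  \<open>A(W(t)) \<le> max (A(W(0)) - t, A(k))\<close> with a level \<open>k\<close> determined by the input, and since \<open>A\<close>
  is bounded, so are the settling times. Global existence follows from this a priori bound and
  Caratheodory's local existence theorem.\<close>

subsection \<open>Monotonicity from one-sided growth bounds\<close>

text \<open>A differential inequality for \<open>W\<close> itself would involve the slope of
  \<open>\<sigma>\<close> along \<open>V2\<close>, which can vanish or blow up at 0. Measuring each
  \<open>V\<^sub>i\<close> in its own time scale makes this slope drop out: a rate is only ever
  attached to \<open>\<theta>\<^sub>i(V\<^sub>i)\<close>, and no comparison between the two time
  scales arises because \<open>A\<close> adds them. The decrease condition concerns the direction
  \<open>f\<close>, which is the velocity of a solution only at almost every time. A continuous
  function whose derivative has the right sign almost everywhere may still rise, as the Cantor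
  function does; the Lipschitz bound that comes from a bounded velocity excludes this. To have such
  a bound, the input, which is only essentially bounded, is changed on a null set. The right-hand
  side is merely continuous, so solutions need not be unique: the bound is proved for every
  solution, and continuation proceeds by successive choices. Being bounded, \<open>A\<close> has no
  inverse on the whole half-line; estimates of \<open>A(W)\<close> are turned back into estimates of
  \<open>W\<close> on the range of \<open>A\<close> only.\<close>

lemma local_nonincreasing_imp_le:
  fixes g :: "real \<Rightarrow> real"
  assumes "a \<le> b" and cont: "continuous_on {a..b} g"
    and loc: "\<And>t. a \<le> t \<Longrightarrow> t < b \<Longrightarrow> \<exists>h>0. \<forall>s\<in>{t..t+h}. s \<le> b \<longrightarrow> g s \<le> g t"
  shows "g b \<le> g a"
proof -
  \<comment> \<open>Real induction: \<open>S\<close> is closed by continuity, and at its supremum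
    \<open>loc\<close> leads further to the right unless the supremum is already
    \<open>b\<close>.\<close>
  define S where "S = {t\<in>{a..b}. g t \<le> g a}"
  have "closed S"
  proof -
    have "S = {a..b} \<inter> g -` {..g a}" by (auto simp: S_def)
    then show ?thesis using continuous_closed_preimage[OF cont, of "{..g a}"] by simp
  qed
  moreover have "S \<noteq> {}" "bdd_above S" using \<open>a \<le> b\<close> by (auto simp: S_def bdd_above_def)
  ultimately have m: "Sup S \<in> S" by (rule closed_contains_Sup[rotated 2])
  define t where "t = Sup S"
  have t: "a \<le> t" "t \<le> b" "g t \<le> g a" using m by (auto simp: S_def t_def)
  show ?thesis
  proof (cases "t < b")
    case True
    then obtain h where h: "h > 0" "\<forall>s\<in>{t..t+h}. s \<le> b \<longrightarrow> g s \<le> g t" using loc t by blast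
    define s where "s = min b (t + h)"
    have s: "s \<in> {t..t+h}" "s \<le> b" using h(1) True by (auto simp: s_def)
    then have "g s \<le> g t" using h(2) by blast
    then have "s \<in> S" using s t by (auto simp: S_def)
    moreover have "s > t" using h True by (auto simp: s_def)
    ultimately show ?thesis
      using cSup_upper[OF \<open>s \<in> S\<close> \<open>bdd_above S\<close>] by (simp add: t_def)
  qed (use t in auto)
qed

text \<open>Cover the exceptional set by an open set \<open>U\<close> of small measure and subtract \<open>L\<close> times the
  measure of \<open>U \<inter> {a..t}\<close>: on \<open>U\<close> this compensates the growth of \<open>g\<close>, elsewhere it only helps.\<close>

lemma AE_nonincreasing_imp_le:
  fixes g :: "real \<Rightarrow> real"
  assumes "a \<le> b" and cont: "continuous_on {a..b} g" and N: "negligible N" and "0 \<le> L"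
    and lip: "\<And>t s. a \<le> t \<Longrightarrow> t \<le> s \<Longrightarrow> s \<le> b \<Longrightarrow> g s - g t \<le> L * (s - t)"
    and ae: "\<And>t e. a \<le> t \<Longrightarrow> t < b \<Longrightarrow> t \<notin> N \<Longrightarrow> 0 < e \<Longrightarrow>
               \<exists>h>0. \<forall>s\<in>{t..t+h}. s \<le> b \<longrightarrow> g s - g t \<le> e * (s - t)"
  shows "g b \<le> g a"
proof -
  \<comment> \<open>\<open>L * e\<close> is the price of the exceptional times, covered by a set of
    measure at most \<open>e\<close>; \<open>e * (b - a)\<close> collects the slack at all other
    times.\<close>
  have key: "g b \<le> g a + L * e + e * (b - a)" if "e > 0" for e
  proof -
    have "N \<in> sets lebesgue" using N by (simp add: negligible_imp_sets)
    then obtain U where U: "open U" "N \<subseteq> U" "U - N \<in> lmeasurable"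
      "emeasure lebesgue (U - N) < ennreal e"
      using sets_lebesgue_outer_open[OF _ \<open>e > 0\<close>] by blast
    have "(U - N) \<union> N = U" using U(2) by blast
    then have UL: "U \<in> lmeasurable"
      using fmeasurable.Un[OF U(3) negligible_imp_measurable[OF N]] by simp
    have mU: "measure lebesgue U \<le> e"
    proof -
      have "measure lebesgue U = measure lebesgue (U - N)"
        using N UL by (simp add: measure_Diff_null_set negligible_iff_null_sets fmeasurableD)
      then show ?thesis
        using U(3,4) \<open>e > 0\<close>
        by (simp add: emeasure_eq_measure2 ennreal_less_iff)
    qed
    define \<phi> where "\<phi> t = measure lebesgue (U \<inter> {a..t})" for t
    have split: "\<phi> s = \<phi> t + measure lebesgue (U \<inter> {t<..s})" if "a \<le> t" "t \<le> s" for s t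
    proof -
      have *: "U \<inter> {a..s} = (U \<inter> {a..t}) \<union> (U \<inter> {t<..s})" using that by auto
      show ?thesis unfolding \<phi>_def *
        by (rule measure_Un_AE) (use UL in \<open>auto intro: fmeasurable_Int_fmeasurable\<close>)
    qed
    have inc: "0 \<le> \<phi> s - \<phi> t" "\<phi> s - \<phi> t \<le> s - t" if "a \<le> t" "t \<le> s" for s t
    proof -
      have "measure lebesgue (U \<inter> {t<..s}) \<le> measure lebesgue {t<..s}"
        by (rule measure_mono_fmeasurable)
          (use UL in \<open>auto simp: fmeasurableD intro: fmeasurableI_null_sets bounded_set_imp_lmeasurable\<close>)
      then show "0 \<le> \<phi> s - \<phi> t" "\<phi> s - \<phi> t \<le> s - t" using split[OF that] that by auto
    qed
    have full: "\<phi> s - \<phi> t = s - t" if "a \<le> t" "t \<le> s" "{t..s} \<subseteq> U" for s t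
    proof -
      have "U \<inter> {t<..s} = {t<..s}" using that by auto
      then show ?thesis using split[OF that(1,2)] that by simp
    qed
    define G where "G t = g t - L * \<phi> t - e * t" for t
    have "G b \<le> G a"
    proof (rule local_nonincreasing_imp_le[OF \<open>a \<le> b\<close>])
      have "1-lipschitz_on {a..b} \<phi>"
      proof (rule lipschitz_onI)
        fix s t assume "s \<in> {a..b}" "t \<in> {a..b}"
        then show "dist (\<phi> s) (\<phi> t) \<le> 1 * dist s t"
          using inc[of s t] inc[of t s] by (auto simp: dist_real_def abs_if not_less)
      qed simp
      then show "continuous_on {a..b} G" unfolding G_def
        by (intro continuous_intros cont lipschitz_on_continuous_on)
      fix t assume t: "a \<le> t" "t < b"
      show "\<exists>h>0. \<forall>s\<in>{t..t+h}. s \<le> b \<longrightarrow> G s \<le> G t"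
      proof (cases "t \<in> N")
        case True
        then obtain h where h: "h > 0" "cball t h \<subseteq> U"
          using U open_contains_cball by blast
        have "G s \<le> G t" if s: "s \<in> {t..t+h}" "s \<le> b" for s
        proof -
          have "{t..s} \<subseteq> U" using h s by (auto simp: cball_eq_atLeastAtMost intro!: subsetD[OF h(2)])
          then have eq: "\<phi> s - \<phi> t = s - t" using full t s by auto
          have "L * \<phi> s - L * \<phi> t = L * (s - t)" using eq by (metis right_diff_distrib)
          moreover have "e * t \<le> e * s" using s \<open>e > 0\<close> by simp
          ultimately show ?thesis using lip[of t s] s t by (simp add: G_def)
        qed
        then show ?thesis using h by blast
      next
        case False
        then obtain h where h: "h > 0" "\<forall>s\<in>{t..t+h}. s \<le> b \<longrightarrow> g s - g t \<le> e * (s - t)"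
          using ae[OF t False \<open>e > 0\<close>] by blast
        have "G s \<le> G t" if s: "s \<in> {t..t+h}" "s \<le> b" for s
        proof -
          have "L * \<phi> t \<le> L * \<phi> s" using inc(1)[of t s] s t \<open>0 \<le> L\<close>
            by (intro mult_left_mono) auto
          moreover have "g s - g t \<le> e * (s - t)" using h s by blast
          ultimately show ?thesis by (simp add: G_def algebra_simps)
        qed
        then show ?thesis using h by blast
      qed
    qed
    have "\<phi> b \<le> measure lebesgue U" unfolding \<phi>_def
      by (rule measure_mono_fmeasurable) (use UL in \<open>auto simp: fmeasurableD\<close>)
    then have "\<phi> b \<le> e" using mU by simp
    have "\<phi> a = 0"
    proof -
      have "\<phi> a \<le> measure lebesgue {a..a}" unfolding \<phi>_def
        by (rule measure_mono_fmeasurable[OF _ _ lmeasurable_interval(1)]) (use UL in \<open>auto simp: fmeasurableD\<close>)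
      moreover have "\<phi> a \<ge> 0" by (simp add: \<phi>_def)
      ultimately show ?thesis by simp
    qed
    have "L * \<phi> b \<le> L * e" using \<open>\<phi> b \<le> e\<close> \<open>0 \<le> L\<close> by (rule mult_left_mono)
    with \<open>G b \<le> G a\<close> \<open>\<phi> a = 0\<close> show ?thesis by (simp add: G_def algebra_simps)
  qed
  have "g b \<le> g a + d" if "d > 0" for d
  proof -
    \<comment> \<open>Chosen so that both errors in \<open>key\<close> together stay below
      \<open>d\<close>; the summand 1 keeps the denominator positive when \<open>L = 0\<close> and
      \<open>a = b\<close>.\<close>
    define e where "e = d / (L + (b - a) + 1)"
    have p: "L + (b - a) + 1 > 0" using \<open>0 \<le> L\<close> \<open>a \<le> b\<close> by simp
    have "e > 0" using that p by (simp add: e_def)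
    have "L * e + e * (b - a) \<le> e * (L + (b - a) + 1)" using \<open>e > 0\<close> by (simp add: algebra_simps)
    also have "\<dots> = d" using p by (simp add: e_def)
    finally show ?thesis using key[OF \<open>e > 0\<close>] by linarith
  qed
  then show ?thesis by (rule field_le_epsilon)
qed

subsection \<open>Lyapunov functions along absolutely continuous curves\<close>

lemma AE_right_derivative_indefinite_integral:
  fixes F :: "real \<Rightarrow> 'a::euclidean_space"
  assumes F: "F integrable_on {a..b}"
  obtains N where "negligible N"
    "\<And>t e. a \<le> t \<Longrightarrow> t < b \<Longrightarrow> t \<notin> N \<Longrightarrow> 0 < e \<Longrightarrow>
       \<exists>d>0. \<forall>h. 0 < h \<and> h < d \<longrightarrow> norm (integral {t..t+h} F - h *\<^sub>R F t) \<le> e * h"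
proof -
  \<comment> \<open>The differentiation theorem wants integrability on every interval. Extension by
    zero provides it, and \<open>h < b - t\<close> keeps \<open>{t..t+h}\<close> inside the region
    where \<open>F'\<close> and \<open>F\<close> agree.\<close>
  define F' where "F' t = (if t \<in> {a..b} then F t else 0)" for t
  have "F' integrable_on UNIV"
    unfolding F'_def using F integrable_restrict_UNIV[of "{a..b}" F] by blast
  then have "F' integrable_on cbox u v" for u v
    by (metis integrable_on_subcbox subset_UNIV)
  then obtain N where N: "negligible N" and
    N2: "\<And>x e. \<lbrakk>x \<notin> N; 0 < e\<rbrakk> \<Longrightarrow> \<exists>d>0. \<forall>h. 0 < h \<and> h < d \<longrightarrow>
       norm (integral (cbox x (x + h *\<^sub>R One)) F' /\<^sub>R h ^ DIM(real) - F' x) < e"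
    using integrable_ccontinuous_explicit[of F'] by metis
  show ?thesis
  proof (rule that[OF N])
    fix t e :: real assume t: "a \<le> t" "t < b" "t \<notin> N" "0 < e"
    obtain d where d: "d > 0" and dh: "\<And>h. 0 < h \<Longrightarrow> h < d \<Longrightarrow> norm (integral {t..t+h} F' /\<^sub>R h - F' t) < e"
      using N2[OF t(3,4)] by auto
    have "norm (integral {t..t+h} F - h *\<^sub>R F t) \<le> e * h" if h: "0 < h" "h < min d (b - t)" for h
    proof -
      have "integral {t..t+h} F' = integral {t..t+h} F"
        using h t by (intro integral_cong) (auto simp: F'_def)
      moreover have "F' t = F t" using t by (simp add: F'_def)
      ultimately have "norm (integral {t..t+h} F /\<^sub>R h - F t) < e" using dh[of h] h by simp
      then have "h * norm (integral {t..t+h} F /\<^sub>R h - F t) \<le> h * e" using h by simp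
      moreover have "integral {t..t+h} F - h *\<^sub>R F t = h *\<^sub>R (integral {t..t+h} F /\<^sub>R h - F t)"
        using h by (simp add: algebra_simps)
      ultimately show ?thesis using h by (simp add: mult.commute)
    qed
    then show "\<exists>d>0. \<forall>h. 0 < h \<and> h < d \<longrightarrow> norm (integral {t..t+h} F - h *\<^sub>R F t) \<le> e * h"
      using d t by (intro exI[of _ "min d (b - t)"]) auto
  qed
qed

lemma dini_deriv_leD:
  assumes "dini_deriv V x v \<le> ereal m" "e > 0"
  obtains d where "d > 0" "\<And>h. 0 < h \<Longrightarrow> h < d \<Longrightarrow> V (x + h *\<^sub>R v) \<le> V x + h * (m + e)"
proof -
  have "dini_deriv V x v < ereal (m + e)"
    using assms by (metis add.right_neutral add_strict_left_mono ereal_less_eq(3) less_ereal.simps(1) order_le_less_trans)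
  then have "eventually (\<lambda>h. ereal ((V (x + h *\<^sub>R v) - V x) / h) < ereal (m + e)) (at_right 0)"
    unfolding dini_deriv_def by (rule Limsup_lessD)
  then obtain d where "d > 0" "\<And>h. 0 < h \<Longrightarrow> h < d \<Longrightarrow> (V (x + h *\<^sub>R v) - V x) / h < m + e"
    unfolding eventually_at_right_field by auto
  then show ?thesis
    by (intro that[of d]) (auto simp: divide_less_eq algebra_simps less_imp_le)
qed

lemma locally_lipschitz_imp_continuous_on:
  assumes "locally_lipschitz V"
  shows "continuous_on S V"
proof (rule continuous_at_imp_continuous_on, rule ballI)
  fix x
  obtain r L where r: "r > 0" and L: "\<And>y z. y \<in> ball x r \<Longrightarrow> z \<in> ball x r \<Longrightarrow> \<bar>V y - V z\<bar> \<le> L * dist y z"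
    using assms unfolding locally_lipschitz_def by blast
  have "\<bar>L\<bar>-lipschitz_on (ball x r) V"
  proof (rule lipschitz_onI)
    fix y z assume "y \<in> ball x r" "z \<in> ball x r"
    then have "\<bar>V y - V z\<bar> \<le> L * dist y z" by (rule L)
    also have "\<dots> \<le> \<bar>L\<bar> * dist y z" by (intro mult_right_mono) auto
    finally show "dist (V y) (V z) \<le> \<bar>L\<bar> * dist y z" by (simp add: dist_real_def)
  qed simp
  then have "continuous_on (ball x r) V" by (rule lipschitz_on_continuous_on)
  then show "isCont V x" using r by (simp add: continuous_on_eq_continuous_at)
qed

text \<open>If \<open>\<Psi>\<close> vanishes at 0, then
  \<open>\<theta>' v * \<Psi> v \<ge> 1\<close> forces \<open>\<theta>'\<close> to blow up there, so
  Lipschitz bounds for a settling function exist only away from 0. The interval is a neighbourhood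
  of \<open>v0\<close> that keeps its distance.\<close>

lemma C1_locally_lipschitz_pos:
  fixes \<theta> :: "real \<Rightarrow> real"
  assumes der: "\<And>v. v > 0 \<Longrightarrow> (\<theta> has_real_derivative \<theta>' v) (at v)"
    and cont: "continuous_on {0<..} \<theta>'" and "v0 > 0"
  obtains L where "L \<ge> 0" "\<And>u v. u \<in> {v0/2..2 * v0} \<Longrightarrow> v \<in> {v0/2..2 * v0} \<Longrightarrow> \<bar>\<theta> u - \<theta> v\<bar> \<le> L * \<bar>u - v\<bar>"
proof -
  have "continuous_on {v0/2..2 * v0} \<theta>'"
    by (rule continuous_on_subset[OF cont]) (use \<open>v0 > 0\<close> in auto)
  then have "bounded (\<theta>' ` {v0/2..2 * v0})"
    by (intro compact_imp_bounded compact_continuous_image) auto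
  then obtain L where L: "\<forall>v\<in>{v0/2..2 * v0}. \<bar>\<theta>' v\<bar> \<le> L" by (auto simp: bounded_iff)
  show ?thesis
  proof (rule that[of L])
    show "L \<ge> 0" using bspec[OF L, of v0] \<open>v0 > 0\<close> by auto
    fix u v assume uv: "u \<in> {v0/2..2 * v0}" "v \<in> {v0/2..2 * v0}"
    have "norm (\<theta> u - \<theta> v) \<le> L * norm (u - v)"
    proof (rule field_differentiable_bound[of "{v0/2..2 * v0}" \<theta> \<theta>'])
      fix z assume "z \<in> {v0/2..2 * v0}"
      then show "(\<theta> has_field_derivative \<theta>' z) (at z within {v0/2..2 * v0})"
        using \<open>v0 > 0\<close> by (intro has_field_derivative_at_within[OF der]) auto
    next
      fix z assume "z \<in> {v0/2..2 * v0}"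
      then show "norm (\<theta>' z) \<le> L" using L by simp
    qed (use uv in \<open>simp_all\<close>)
    then show "\<bar>\<theta> u - \<theta> v\<bar> \<le> L * \<bar>u - v\<bar>" by simp
  qed
qed

section \<open>Curves with bounded integrable velocity\<close>

lemma norm_integral_le_const:
  fixes F :: "real \<Rightarrow> 'a::euclidean_space"
  assumes "a \<le> b" "F integrable_on {a..b}" "\<And>t. t \<in> {a..b} \<Longrightarrow> norm (F t) \<le> M"
  shows "norm (integral {a..b} F) \<le> M * (b - a)"
proof -
  have "norm (integral {a..b} F) \<le> integral {a..b} (\<lambda>_. M)"
    by (rule integral_norm_bound_integral) (use assms in auto)
  then show ?thesis using \<open>a \<le> b\<close> by (simp add: mult.commute)
qed

text \<open>Increments instead of values from a base point make the notion stable under subintervals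
  and linear maps. A bound on \<open>F\<close> at every time, not just almost every time, makes
  \<open>x\<close> Lipschitz.\<close>

definition trajectory :: "real \<Rightarrow> real \<Rightarrow> (real \<Rightarrow> 'a::euclidean_space) \<Rightarrow> (real \<Rightarrow> 'a) \<Rightarrow> bool" where
  "trajectory a b F x \<longleftrightarrow> F integrable_on {a..b} \<and> bounded (F ` {a..b}) \<and>
     (\<forall>s t. a \<le> s \<longrightarrow> s \<le> t \<longrightarrow> t \<le> b \<longrightarrow> x t - x s = integral {s..t} F)"

lemma trajectoryD:
  assumes "trajectory a b F x"
  shows "F integrable_on {a..b}" "bounded (F ` {a..b})"
    "a \<le> s \<Longrightarrow> s \<le> t \<Longrightarrow> t \<le> b \<Longrightarrow> x t - x s = integral {s..t} F"
  using assms unfolding trajectory_def by blast+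

lemma trajectory_subinterval:
  assumes "trajectory a b F x" "a \<le> c" "d \<le> b"
  shows "trajectory c d F x"
proof -
  have sub: "{c..d} \<subseteq> {a..b}" using assms by auto
  show ?thesis
    unfolding trajectory_def
  proof (intro conjI allI impI)
    show "F integrable_on {c..d}"
      using trajectoryD(1)[OF assms(1)] sub by (rule integrable_on_subinterval)
    show "bounded (F ` {c..d})"
      using trajectoryD(2)[OF assms(1)] image_mono[OF sub] by (rule bounded_subset)
    fix s t assume "c \<le> s" "s \<le> t" "t \<le> d"
    then show "x t - x s = integral {s..t} F"
      using assms by (intro trajectoryD(3)[OF assms(1)]) auto
  qed
qed

text \<open>Serves for \<open>fst\<close> and \<open>snd\<close>, which split a trajectory of the
  interconnection into those of the two subsystems.\<close>

lemma trajectory_linear_image: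
  assumes "trajectory a b F x" "bounded_linear h"
  shows "trajectory a b (\<lambda>t. h (F t)) (\<lambda>t. h (x t))"
  unfolding trajectory_def
proof (intro conjI allI impI)
  have F: "F integrable_on {a..b}" using assms(1) by (rule trajectoryD)
  show "(\<lambda>t. h (F t)) integrable_on {a..b}"
    using integrable_linear[OF F assms(2)] by (simp add: o_def)
  show "bounded ((\<lambda>t. h (F t)) ` {a..b})"
    using bounded_linear_image[OF _ assms(2), of "F ` {a..b}"] trajectoryD(2)[OF assms(1)] by (simp add: image_image)
  fix s t assume st: "a \<le> s" "s \<le> t" "t \<le> b"
  have "F integrable_on {s..t}" by (rule integrable_on_subinterval[OF F]) (use st in auto)
  from integral_linear[OF this assms(2)] have "integral {s..t} (\<lambda>t. h (F t)) = h (integral {s..t} F)"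
    by (simp add: o_def)
  also have "integral {s..t} F = x t - x s" using trajectoryD(3)[OF assms(1) st] by simp
  finally show "h (x t) - h (x s) = integral {s..t} (\<lambda>t. h (F t))"
    by (simp add: linear_diff[OF bounded_linear.linear[OF assms(2)]])
qed

lemma trajectory_lipschitz:
  assumes "trajectory a b F x" "\<And>t. t \<in> {a..b} \<Longrightarrow> norm (F t) \<le> M"
    "a \<le> s" "s \<le> t" "t \<le> b"
  shows "norm (x t - x s) \<le> M * (t - s)"
proof -
  have "norm (integral {s..t} F) \<le> M * (t - s)"
  proof (rule norm_integral_le_const)
    show "F integrable_on {s..t}"
      by (rule integrable_on_subinterval[OF trajectoryD(1)[OF assms(1)]]) (use assms in auto)
  qed (use assms in auto)
  then show ?thesis using trajectoryD(3)[OF assms(1,3-5)] by simp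
qed

lemma trajectory_continuous_on:
  assumes "trajectory a b F x"
  shows "continuous_on {a..b} x"
proof -
  obtain M where M: "\<forall>z\<in>F ` {a..b}. norm z \<le> M" using trajectoryD(2)[OF assms] unfolding bounded_iff by blast
  have "\<bar>M\<bar>-lipschitz_on {a..b} x"
  proof (rule lipschitz_onI)
    have M': "norm (F t) \<le> \<bar>M\<bar>" if "t \<in> {a..b}" for t using M that by force
    fix s t assume "s \<in> {a..b}" "t \<in> {a..b}"
    then show "dist (x s) (x t) \<le> \<bar>M\<bar> * dist s t"
      using trajectory_lipschitz[OF assms M', of s t] trajectory_lipschitz[OF assms M', of t s]
      by (cases "s \<le> t") (auto simp: dist_norm norm_minus_commute)
  qed simp
  then show ?thesis by (rule lipschitz_on_continuous_on)
qed

text \<open>The model is the integral of \<open>1 / \<Psi>\<close> from 0 to \<open>v\<close>, the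
  time in which \<open>v' = - \<Psi> v\<close> reaches 0. An inequality in place of the equation
  admits closed-form choices, and 0 is left out of the derivative condition because the slope is
  typically infinite there.\<close>

definition settling_function :: "(real \<Rightarrow> real) \<Rightarrow> (real \<Rightarrow> real) \<Rightarrow> bool" where
  "settling_function \<Psi> \<theta> \<longleftrightarrow> class_K \<theta> \<and> bdd_above (\<theta> ` {0..}) \<and>
     (\<exists>\<theta>'. continuous_on {0<..} \<theta>' \<and>
        (\<forall>v>0. (\<theta> has_real_derivative \<theta>' v) (at v) \<and> \<theta>' v * \<Psi> v \<ge> 1))"

text \<open>The function \<open>\<theta> (V (x t)) + t\<close> does not increase. At almost every
  time \<open>x (t + h)\<close> differs from \<open>x t + h *\<^sub>R F t\<close> by o(h), so the
  local Lipschitz bound on \<open>V\<close> carries the Dini bound from the straight line over to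
  the curve; the derivative of \<open>\<theta>\<close> turns the rate \<open>- \<Psi>\<close> into
  at most -1. Positivity of \<open>V\<close> keeps \<open>\<theta>\<close> where it is
  differentiable.\<close>

lemma lyapunov_decrease:
  fixes x F :: "real \<Rightarrow> 'a::euclidean_space" and V :: "'a \<Rightarrow> real"
  assumes "a \<le> b" and traj: "trajectory a b F x"
    and V: "locally_lipschitz V" and pos: "\<And>t. t \<in> {a..b} \<Longrightarrow> V (x t) > 0"
    and decr: "\<And>t. t \<in> {a..b} \<Longrightarrow> dini_deriv V (x t) (F t) \<le> ereal (- \<Psi> (V (x t)))"
    and settling: "settling_function \<Psi> \<theta>"
  shows "\<theta> (V (x b)) \<le> \<theta> (V (x a)) - (b - a)"
proof -
  have F: "F integrable_on {a..b}"
    and x: "\<And>s t. a \<le> s \<Longrightarrow> s \<le> t \<Longrightarrow> t \<le> b \<Longrightarrow> x t - x s = integral {s..t} F"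
    using trajectoryD[OF traj] by blast+
  obtain M where M: "\<forall>z\<in>F ` {a..b}. norm z \<le> M" using trajectoryD(2)[OF traj] unfolding bounded_iff by blast
  then have M: "norm (F t) \<le> M" if "t \<in> {a..b}" for t using that by blast
  obtain \<theta>' where der: "\<And>v. v > 0 \<Longrightarrow> (\<theta> has_real_derivative \<theta>' v) (at v)"
    and cont': "continuous_on {0<..} \<theta>'" and rate: "\<And>v. v > 0 \<Longrightarrow> \<theta>' v * \<Psi> v \<ge> 1"
    using settling by (auto simp: settling_function_def)
  have mono: "strict_mono_on {0..} \<theta>" using settling by (simp add: settling_function_def class_K_def)
  have M0: "M \<ge> 0" using order_trans[OF norm_ge_zero M[of a]] \<open>a \<le> b\<close> by simp
  note lipx = trajectory_lipschitz[OF traj M]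
  note contx = trajectory_continuous_on[OF traj]
  have contVx: "continuous_on {a..b} (\<lambda>t. V (x t))"
    by (rule continuous_on_compose2[OF locally_lipschitz_imp_continuous_on[OF V] contx, of UNIV]) auto
  have cont\<theta>: "continuous_on {0<..} \<theta>"
    by (rule continuous_at_imp_continuous_on) (auto intro: DERIV_isCont der)
  define g where "g t = \<theta> (V (x t)) + t" for t
  have contg: "continuous_on {a..b} g"
    unfolding g_def
    by (intro continuous_intros continuous_on_compose2[OF cont\<theta> contVx]) (use pos in auto)
  obtain N where N: "negligible N"
    and N2: "\<And>t e. a \<le> t \<Longrightarrow> t < b \<Longrightarrow> t \<notin> N \<Longrightarrow> 0 < e \<Longrightarrow>
       \<exists>d>0. \<forall>h. 0 < h \<and> h < d \<longrightarrow> norm (integral {t..t+h} F - h *\<^sub>R F t) \<le> e * h"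
    using AE_right_derivative_indefinite_integral[OF F] by blast
  \<comment> \<open>Lipschitz constants of \<open>V\<close> and \<open>\<theta>\<close> exist only
    near each point of the curve. The almost-everywhere argument therefore runs on short intervals,
    which the local criterion joins.\<close>
  have "g b \<le> g a"
  proof (rule local_nonincreasing_imp_le[OF \<open>a \<le> b\<close> contg])
    fix t assume t: "a \<le> t" "t < b"
    define v0 where "v0 = V (x t)"
    have "v0 > 0" using pos t by (simp add: v0_def)
    obtain r L0 where r: "r > 0" and L0: "\<And>y z. y \<in> ball (x t) r \<Longrightarrow> z \<in> ball (x t) r \<Longrightarrow> \<bar>V y - V z\<bar> \<le> L0 * dist y z"
      using V unfolding locally_lipschitz_def by blast
    define L where "L = \<bar>L0\<bar>"
    have L: "\<bar>V y - V z\<bar> \<le> L * dist y z" if "y \<in> ball (x t) r" "z \<in> ball (x t) r" for y z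
    proof -
      have "\<bar>V y - V z\<bar> \<le> L0 * dist y z" using that by (rule L0)
      also have "\<dots> \<le> L * dist y z" unfolding L_def by (intro mult_right_mono) auto
      finally show ?thesis .
    qed
    have "L \<ge> 0" by (simp add: L_def)
    obtain K where "K \<ge> 0" and K: "\<And>u v. u \<in> {v0/2..2 * v0} \<Longrightarrow> v \<in> {v0/2..2 * v0} \<Longrightarrow> \<bar>\<theta> u - \<theta> v\<bar> \<le> K * \<bar>u - v\<bar>"
      using C1_locally_lipschitz_pos[OF der cont' \<open>v0 > 0\<close>] by blast
    obtain d1 where d1: "d1 > 0" "\<And>s. s \<in> {a..b} \<Longrightarrow> dist s t < d1 \<Longrightarrow> dist (x s) (x t) < r"
      using contx r t unfolding continuous_on_iff by (metis atLeastAtMost_iff less_eq_real_def)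
    obtain d2 where d2: "d2 > 0" "\<And>s. s \<in> {a..b} \<Longrightarrow> dist s t < d2 \<Longrightarrow> dist (V (x s)) (V (x t)) < v0 / 2"
      using contVx \<open>v0 > 0\<close> t unfolding continuous_on_iff by (metis atLeastAtMost_iff less_eq_real_def half_gt_zero)
    define h0 where "h0 = min d1 d2 / 2"
    have h0: "h0 > 0" "h0 < d1" "h0 < d2" using d1 d2 by (auto simp: h0_def)
    have near: "x s \<in> ball (x t) r" "V (x s) \<in> {v0/2..2 * v0}" if "t \<le> s" "s \<le> t + h0" "s \<le> b" for s
    proof -
      have *: "s \<in> {a..b}" "dist s t < d1" "dist s t < d2" using that t h0 by (auto simp: dist_real_def)
      show "x s \<in> ball (x t) r" using d1(2)[OF *(1,2)] by (simp add: dist_commute)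
      have "\<bar>V (x s) - v0\<bar> < v0 / 2" using d2(2)[OF *(1,3)] by (simp add: dist_real_def v0_def)
      then show "V (x s) \<in> {v0/2..2 * v0}" by (auto simp: abs_if split: if_splits)
    qed
    have "g s \<le> g t" if s: "s \<in> {t..t+h0}" "s \<le> b" for s
    \<comment> \<open>\<open>K\<close>, \<open>L\<close> and \<open>M\<close> bound the growth of
      \<open>\<theta>\<close>, \<open>V\<close> and \<open>x\<close>; the 1 accounts for the summand
      \<open>t\<close> in \<open>g\<close>.\<close>
    proof (rule AE_nonincreasing_imp_le[OF _ _ N, of t s g "K * L * M + 1"])
      show "t \<le> s" using s by simp
      show "continuous_on {t..s} g" by (rule continuous_on_subset[OF contg]) (use s t in auto)
      show "0 \<le> K * L * M + 1" using \<open>K \<ge> 0\<close> \<open>L \<ge> 0\<close> M0 by simp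
    next
      fix t1 t2 assume tt: "t \<le> t1" "t1 \<le> t2" "t2 \<le> s"
      have "\<bar>\<theta> (V (x t2)) - \<theta> (V (x t1))\<bar> \<le> K * \<bar>V (x t2) - V (x t1)\<bar>"
        by (rule K) (use near tt s in auto)
      also have "\<dots> \<le> K * (L * dist (x t2) (x t1))"
        by (intro mult_left_mono L \<open>K \<ge> 0\<close>) (use near tt s in auto)
      also have "\<dots> \<le> K * (L * (M * (t2 - t1)))"
        unfolding dist_norm
        by (intro mult_left_mono lipx \<open>K \<ge> 0\<close> \<open>L \<ge> 0\<close>) (use tt s t in auto)
      finally show "g t2 - g t1 \<le> (K * L * M + 1) * (t2 - t1)"
        by (simp add: g_def algebra_simps)
    next
      fix t1 e :: real assume t1: "t \<le> t1" "t1 < s" "t1 \<notin> N" "0 < e"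
      define v where "v = V (x t1)"
      have ab: "t1 \<in> {a..b}" "a \<le> t1" "t1 < b" using t1 s t by auto
      have "v > 0" using pos[OF ab(1)] by (simp add: v_def)
      \<comment> \<open>Error budget: \<open>\<theta>' v * \<delta>\<close> takes at most
        \<open>e/2\<close>, and the remainder in the derivative of \<open>\<theta>\<close> takes the
        other half. \<open>\<delta>\<close> in turn splits into \<open>e1\<close> for the Dini bound
        and \<open>L * e1\<close> for leaving the straight line.\<close>
      define \<delta> where "\<delta> = e / (2 * (\<bar>\<theta>' v\<bar> + 1))"
      have "\<delta> > 0" using t1 by (simp add: \<delta>_def add_nonneg_pos)
      define e1 where "e1 = \<delta> / (1 + L)"
      have "e1 > 0" using \<open>\<delta> > 0\<close> \<open>L \<ge> 0\<close> by (simp add: e1_def)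
      have e1L: "e1 + L * e1 = \<delta>"
      proof -
        have "e1 * (1 + L) = \<delta>" using \<open>L \<ge> 0\<close> by (simp add: e1_def)
        then show ?thesis by (simp add: algebra_simps)
      qed
      define m where "m = - \<Psi> v"
      have x1: "x t1 \<in> ball (x t) r" using near t1 s by auto
      obtain da where da: "da > 0" "\<And>h. 0 < h \<Longrightarrow> h < da \<Longrightarrow> norm (integral {t1..t1+h} F - h *\<^sub>R F t1) \<le> e1 * h"
        using N2[OF ab(2,3) t1(3) \<open>e1 > 0\<close>] by blast
      obtain db where db: "db > 0" "\<And>h. 0 < h \<Longrightarrow> h < db \<Longrightarrow> V (x t1 + h *\<^sub>R F t1) \<le> V (x t1) + h * (m + e1)"
        using dini_deriv_leD[OF decr[OF ab(1)] \<open>e1 > 0\<close>] unfolding m_def v_def by metis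
      have "((\<lambda>h. x t1 + h *\<^sub>R F t1) \<longlongrightarrow> x t1 + 0 *\<^sub>R F t1) (at_right 0)"
        by (intro tendsto_intros)
      then have "eventually (\<lambda>h. x t1 + h *\<^sub>R F t1 \<in> ball (x t) r) (at_right 0)"
        by (rule topological_tendstoD) (use x1 in auto)
      then obtain dc where dc: "dc > 0" "\<And>h. 0 < h \<Longrightarrow> h < dc \<Longrightarrow> x t1 + h *\<^sub>R F t1 \<in> ball (x t) r"
        unfolding eventually_at_right_field by auto
      have "((\<lambda>h. v + h * (m + \<delta>)) \<longlongrightarrow> v + 0 * (m + \<delta>)) (at_right 0)"
        by (intro tendsto_intros)
      then have "eventually (\<lambda>h. v + h * (m + \<delta>) > 0) (at_right 0)"
        by (rule order_tendstoD) (use \<open>v > 0\<close> in auto)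
      then obtain dd where dd: "dd > 0" "\<And>h. 0 < h \<Longrightarrow> h < dd \<Longrightarrow> v + h * (m + \<delta>) > 0"
        unfolding eventually_at_right_field by auto
      \<comment> \<open>As \<open>\<theta>\<close> is increasing, \<open>V (x (t1 + h))\<close> may
        be replaced by its affine upper bound, so only this differentiable function of
        \<open>h\<close> has to be expanded.\<close>
      have "((\<lambda>h. \<theta> (v + h * (m + \<delta>))) has_real_derivative \<theta>' v * (m + \<delta>)) (at 0)"
        by (rule DERIV_chain2[where f = \<theta>])
           (use der[OF \<open>v > 0\<close>] in \<open>auto intro!: derivative_eq_intros\<close>)
      then obtain de where de: "de > 0"
        "\<And>h. norm (h - 0) < de \<Longrightarrow> norm (\<theta> (v + h * (m + \<delta>)) - \<theta> (v + 0 * (m + \<delta>)) - (\<theta>' v * (m + \<delta>)) * (h - 0)) \<le> e/2 * norm (h - 0)"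
        using t1(4) unfolding has_field_derivative_def has_derivative_at_alt by (meson half_gt_zero)
      define h1 where "h1 = Min {da, db, dc, dd, de} / 2"
      have h1: "h1 > 0" using da db dc dd de by (simp add: h1_def)
      have h1': "h1 < da" "h1 < db" "h1 < dc" "h1 < dd" "h1 < de"
      proof -
        have "h1 < Min {da, db, dc, dd, de}" using h1 unfolding h1_def by linarith
        then show "h1 < da" "h1 < db" "h1 < dc" "h1 < dd" "h1 < de" by auto
      qed
      have "g (t1 + h) - g t1 \<le> e * h" if h: "0 < h" "h \<le> h1" "t1 + h \<le> s" for h
      proof -
        have xh: "x (t1 + h) \<in> ball (x t) r" using near[of "t1 + h"] h t1 s by auto
        have xd: "x (t1 + h) - (x t1 + h *\<^sub>R F t1) = integral {t1..t1+h} F - h *\<^sub>R F t1"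
          using x[of t1 "t1 + h"] ab h s by (simp add: algebra_simps)
        have "dist (x (t1 + h)) (x t1 + h *\<^sub>R F t1) \<le> e1 * h"
          unfolding dist_norm xd using da(2)[of h] h h1' by simp
        then have "L * dist (x (t1 + h)) (x t1 + h *\<^sub>R F t1) \<le> L * (e1 * h)"
          using \<open>L \<ge> 0\<close> by (rule mult_left_mono)
        moreover have "\<bar>V (x (t1 + h)) - V (x t1 + h *\<^sub>R F t1)\<bar> \<le> L * dist (x (t1 + h)) (x t1 + h *\<^sub>R F t1)"
          by (rule L[OF xh]) (use dc h h1' in auto)
        moreover have "V (x t1 + h *\<^sub>R F t1) \<le> v + h * (m + e1)" using db(2)[of h] h h1' by (simp add: v_def)
        ultimately have "V (x (t1 + h)) \<le> v + h * (m + e1) + L * (e1 * h)" by linarith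
        also have "\<dots> = v + h * (m + (e1 + L * e1))" by (simp add: algebra_simps)
        finally have Vle: "V (x (t1 + h)) \<le> v + h * (m + \<delta>)" by (simp only: e1L)
        moreover have "V (x (t1 + h)) > 0" using pos h t1 s t by auto
        ultimately have "\<theta> (V (x (t1 + h))) \<le> \<theta> (v + h * (m + \<delta>))"
          using mono by (intro strict_mono_on_leD[OF mono]) auto
        also have "\<dots> \<le> \<theta> v + (\<theta>' v * (m + \<delta>)) * h + e / 2 * h"
        proof -
          have "\<bar>\<theta> (v + h * (m + \<delta>)) - \<theta> v - \<theta>' v * (m + \<delta>) * h\<bar> \<le> e / 2 * h"
            using de(2)[of h] h h1' by simp
          then show ?thesis by linarith
        qed
        also have "\<theta>' v * (m + \<delta>) \<le> - 1 + e / 2"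
        proof -
          have "\<theta>' v * m \<le> - 1" using rate[OF \<open>v > 0\<close>] by (simp add: m_def)
          moreover have "\<theta>' v * \<delta> \<le> e / 2"
          proof -
            have "\<bar>\<theta>' v\<bar> + 1 \<noteq> 0" by linarith
            then have "(\<bar>\<theta>' v\<bar> + 1) * \<delta> = e / 2" unfolding \<delta>_def by (simp add: field_simps)
            moreover have "\<theta>' v * \<delta> \<le> (\<bar>\<theta>' v\<bar> + 1) * \<delta>" using \<open>\<delta> > 0\<close> by (intro mult_right_mono) auto
            ultimately show ?thesis by simp
          qed
          ultimately show ?thesis by (simp add: algebra_simps)
        qed
        finally have "\<theta> (V (x (t1 + h))) \<le> \<theta> v + (- 1 + e / 2) * h + e / 2 * h" using h by simp
        then show ?thesis by (simp add: g_def v_def algebra_simps)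
      qed
      note step = this
      have "g s' - g t1 \<le> e * (s' - t1)" if "s' \<in> {t1..t1+h1}" "s' \<le> s" for s'
        using step[of "s' - t1"] that by (cases "s' = t1") auto
      then show "\<exists>h>0. \<forall>s'\<in>{t1..t1+h}. s' \<le> s \<longrightarrow> g s' - g t1 \<le> e * (s' - t1)"
        using h1 by blast
    qed
    then show "\<exists>h>0. \<forall>s\<in>{t..t+h}. s \<le> b \<longrightarrow> g s \<le> g t" using h0 by blast
  qed
  then show ?thesis by (simp add: g_def)
qed

subsection \<open>Comparison functions\<close>

lemma class_K_D:
  assumes "class_K f"
  shows "continuous_on {0..} f" "strict_mono_on {0..} f" "f 0 = 0" "0 \<le> s \<Longrightarrow> 0 \<le> f s"
    "0 \<le> s \<Longrightarrow> s \<le> t \<Longrightarrow> f s \<le> f t" "0 \<le> s \<Longrightarrow> s < t \<Longrightarrow> f s < f t"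
proof -
  show "continuous_on {0..} f" "f 0 = 0" "0 \<le> s \<Longrightarrow> 0 \<le> f s" and sm: "strict_mono_on {0..} f"
    using assms by (auto simp: class_K_def)
  show "0 \<le> s \<Longrightarrow> s \<le> t \<Longrightarrow> f s \<le> f t" "0 \<le> s \<Longrightarrow> s < t \<Longrightarrow> f s < f t"
    using strict_mono_on_leD[OF sm, of s t] strict_mono_onD[OF sm, of s t] by auto
qed

lemma class_K_le_iff: "class_K f \<Longrightarrow> 0 \<le> s \<Longrightarrow> 0 \<le> t \<Longrightarrow> f s \<le> f t \<longleftrightarrow> s \<le> t"
  using class_K_D(5,6)[of f] by (meson leD not_le)

lemma class_K_less_iff: "class_K f \<Longrightarrow> 0 \<le> s \<Longrightarrow> 0 \<le> t \<Longrightarrow> f s < f t \<longleftrightarrow> s < t"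
  using class_K_le_iff[of f t s] by auto

lemma class_KI:
  assumes "continuous_on {0..} f" "\<And>s t. 0 \<le> s \<Longrightarrow> s < t \<Longrightarrow> f s < f t" "f 0 = 0"
  shows "class_K f"
  unfolding class_K_def
proof (intro conjI allI impI)
  show "strict_mono_on {0..} f" by (auto intro!: strict_mono_onI assms(2))
  fix s :: real assume "0 \<le> s"
  then show "0 \<le> f s" using assms(2)[of 0 s] assms(3) by (cases "s = 0") auto
qed fact+

lemma class_K_comp:
  assumes "class_K f" "class_K g"
  shows "class_K (\<lambda>s. f (g s))"
proof (rule class_KI)
  show "continuous_on {0..} (\<lambda>s. f (g s))"
    by (rule continuous_on_compose2[OF class_K_D(1)[OF assms(1)] class_K_D(1)[OF assms(2)]])
       (use class_K_D(4)[OF assms(2)] in auto)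
qed (use class_K_D[OF assms(1)] class_K_D[OF assms(2)] in auto)

lemma class_K_add:
  assumes "class_K f" "class_K g"
  shows "class_K (\<lambda>s. f s + g s)"
  by (rule class_KI)
     (use class_K_D[OF assms(1)] class_K_D[OF assms(2)] in \<open>auto intro!: continuous_intros add_strict_mono\<close>)

lemma class_K_max:
  assumes "class_K f" "class_K g"
  shows "class_K (\<lambda>s. max (f s) (g s))"
proof (rule class_KI)
  fix s t :: real assume st: "0 \<le> s" "s < t"
  show "max (f s) (g s) < max (f t) (g t)"
    using class_K_D(6)[OF assms(1) st] class_K_D(6)[OF assms(2) st] by auto
qed (use class_K_D[OF assms(1)] class_K_D[OF assms(2)] in \<open>auto intro!: continuous_intros\<close>)

text \<open>A class K function need not be onto the half-line, but its range is an interval starting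
  at 0. For the bounded \<open>A\<close> this is what places arguments in the domain of its
  inverse.\<close>

lemma class_K_image_downward:
  assumes "class_K f" "0 \<le> s" "0 \<le> z" "z \<le> f s"
  shows "z \<in> f ` {0..}"
proof -
  have "\<exists>x\<ge>0. x \<le> s \<and> f x = z"
    by (rule IVT') (use assms class_K_D[OF assms(1)] in \<open>auto intro: continuous_on_subset\<close>)
  then show ?thesis by auto
qed

text \<open>A monotone function with open image has no jumps and is continuous. The inverse of
  \<open>f\<close> alone has image \<open>{0..}\<close>, which is not open; after extending
  \<open>f\<close> by the identity to negative arguments the inverse has image
  \<open>UNIV\<close>.\<close>

lemma class_K_inverse:
  assumes f: "class_K f"
  obtains g where "continuous_on (f ` {0..}) g" "\<And>s. 0 \<le> s \<Longrightarrow> g (f s) = s"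
proof -
  define F where "F s = (if s < 0 then s else f s)" for s
  have sm: "strict_mono F"
  proof (rule strict_monoI)
    fix s t :: real assume "s < t"
    then show "F s < F t" using class_K_D(6)[OF f, of s t] class_K_D(4)[OF f, of t] by (auto simp: F_def)
  qed
  have eq: "F = (\<lambda>s. if s \<le> 0 then s else f s)"
    using class_K_D(3)[OF f] by (auto simp: F_def fun_eq_iff)
  have "continuous_on UNIV F" unfolding eq
    by (rule continuous_on_cases_1)
       (use class_K_D(1,3)[OF f] in \<open>auto intro: continuous_intros simp: atLeast_def\<close>)
  then have op: "open (F ` UNIV)"
    using strict_mono_imp_inj_on[OF sm] by (intro invariance_of_domain) auto
  define g where "g = inv F"
  have gF: "g (F s) = s" for s
    unfolding g_def using sm strict_mono_eq by (intro inv_f_f injI) blast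
  then have im: "g ` range F = UNIV" by (auto simp: image_iff)
  have "continuous_on (range F) g"
  proof (rule continuous_onI_mono)
    show "open (g ` range F)" by (simp add: im)
    fix y z assume "y \<in> range F" "z \<in> range F" "y \<le> z"
    then obtain s t where "y = F s" "z = F t" "F s \<le> F t" by auto
    then show "g y \<le> g z" using sm by (simp add: gF strict_mono_less_eq)
  qed
  moreover have Ff: "F s = f s" if "0 \<le> s" for s using that by (simp add: F_def)
  moreover have "f ` {0..} \<subseteq> range F"
  proof
    fix y assume "y \<in> f ` {0..}"
    then obtain s where "0 \<le> s" "y = f s" by auto
    then show "y \<in> range F" using Ff by (intro image_eqI[of _ _ s]) auto
  qed
  ultimately have "continuous_on (f ` {0..}) g" by (metis continuous_on_subset)
  moreover have "g (f s) = s" if "0 \<le> s" for s using gF[of s] Ff[OF that] by simp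
  ultimately show ?thesis by (rule that)
qed

lemma class_Kinf_image:
  assumes "class_Kinf f"
  shows "f ` {0..} = {0..}"
proof
  have f: "class_K f" using assms by (simp add: class_Kinf_def)
  show "f ` {0..} \<subseteq> {0..}" using class_K_D(4)[OF f] by auto
  show "{0..} \<subseteq> f ` {0..}"
  proof
    fix y :: real assume y: "y \<in> {0..}"
    have "eventually (\<lambda>s. y \<le> f s) at_top"
      using assms by (auto simp: class_Kinf_def filterlim_at_top)
    then obtain s0 where "\<And>s. s0 \<le> s \<Longrightarrow> y \<le> f s" by (auto simp: eventually_at_top_linorder)
    then have "y \<le> f (max s0 0)" by simp
    then show "y \<in> f ` {0..}" using class_K_image_downward[OF f, of "max s0 0" y] y by simp
  qed
qed

lemma class_Kinf_inverse:
  assumes "class_Kinf f"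
  obtains g where "class_K g" "\<And>s. 0 \<le> s \<Longrightarrow> g (f s) = s"
proof -
  have f: "class_K f" using assms by (simp add: class_Kinf_def)
  obtain g where g: "continuous_on {0..} g" "\<And>s. 0 \<le> s \<Longrightarrow> g (f s) = s"
    using class_K_inverse[OF f] class_Kinf_image[OF assms] by metis
  have fg: "f (g s) = s \<and> 0 \<le> g s" if "0 \<le> s" for s
  proof -
    obtain t where "0 \<le> t" "s = f t" using class_Kinf_image[OF assms] \<open>0 \<le> s\<close> by (metis atLeast_iff imageE)
    then show ?thesis using g(2) by simp
  qed
  have "class_K g"
  proof (rule class_KI[OF g(1)])
    fix s t :: real assume "0 \<le> s" "s < t"
    then show "g s < g t" using fg[of s] fg[of t] class_K_less_iff[OF f, of "g s" "g t"] by simp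
  next
    show "g 0 = 0" using g(2)[of 0] class_K_D(3)[OF f] by simp
  qed
  then show ?thesis using g(2) by (rule that)
qed

text \<open>The witness is \<open>\<theta>(v) = K v\<^sup>a / (1 + v\<^sup>a)\<close>, where \<open>a\<close> is small enough for both exponents
  of \<open>\<Psi>\<close>.\<close>

lemma class_KFxT_settling_function:
  assumes "class_KFxT \<Psi>"
  obtains \<theta> where "settling_function \<Psi> \<theta>"
proof -
  obtain c1 c2 p1 p2 :: real where c: "c1 > 0" "c2 > 0" and p: "0 < p1" "p1 < 1" "p2 > 1"
    and \<Psi>: "\<And>s. s \<ge> 0 \<Longrightarrow> \<Psi> s = c1 * s powr p1 + c2 * s powr p2"
    using assms unfolding class_KFxT_def by blast
  \<comment> \<open>\<open>a \<le> 1 - p1\<close> makes the exponent \<open>p1 + a - 1\<close>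
    non-positive, so that term is at least \<open>c1\<close> for \<open>v \<le> 1\<close>;
    \<open>a \<le> p2 - 1\<close> gives \<open>p2 + a - 1 \<ge> 2 * a\<close>, which beats
    \<open>w\<^sup>2\<close> for \<open>v \<ge> 1\<close>. The 4 in \<open>K\<close> is the factor
    in \<open>(1 + w)\<^sup>2 \<le> 4\<close> and \<open>(1 + w)\<^sup>2 \<le> 4 * w\<^sup>2\<close>
    in these two cases.\<close>
  define a where "a = min (1 - p1) (p2 - 1)"
  define c where "c = min c1 c2"
  define K where "K = 4 / (a * c)"
  have a: "a > 0" "a \<le> 1 - p1" "a \<le> p2 - 1" using p by (auto simp: a_def)
  have c': "c > 0" "c \<le> c1" "c \<le> c2" using c by (auto simp: c_def)
  have K: "K > 0" using a c' by (simp add: K_def)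
  define \<theta> where "\<theta> v = K - K / (1 + v powr a)" for v
  define \<theta>' where "\<theta>' v = K * (a * v powr (a - 1)) / (1 + v powr a)\<^sup>2" for v
  have pos: "1 + v powr a > 0" for v :: real by (simp add: add_pos_nonneg)
  show ?thesis
  proof (rule that[of \<theta>], unfold settling_function_def, intro conjI exI[of _ \<theta>'] allI impI)
    show "class_K \<theta>"
    proof (rule class_KI)
      show "continuous_on {0..} \<theta>" unfolding \<theta>_def
        by (intro continuous_intros continuous_on_powr') (use a pos in \<open>auto simp: less_imp_neq[symmetric]\<close>)
      show "\<theta> 0 = 0" using a by (simp add: \<theta>_def)
      fix s t :: real assume "0 \<le> s" "s < t"
      then have "s powr a < t powr a" using a by (intro powr_less_mono2) auto
      then have "K / (1 + t powr a) < K / (1 + s powr a)"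
        using K pos by (intro divide_strict_left_mono mult_pos_pos) auto
      then show "\<theta> s < \<theta> t" by (simp add: \<theta>_def)
    qed
    have "\<theta> v \<le> K" for v using K pos[of v] by (simp add: \<theta>_def less_imp_le)
    then show "bdd_above (\<theta> ` {0..})" by (auto intro!: bdd_aboveI)
    show "continuous_on {0<..} \<theta>'" unfolding \<theta>'_def
      by (intro continuous_intros) (use pos in \<open>auto simp: less_imp_neq[symmetric]\<close>)
    fix v :: real assume v: "v > 0"
    show "(\<theta> has_real_derivative \<theta>' v) (at v)"
      unfolding \<theta>_def \<theta>'_def
      by (rule derivative_eq_intros refl | use v pos[of v] in \<open>simp add: field_simps power2_eq_square\<close>)+
    show "\<theta>' v * \<Psi> v \<ge> 1"
    proof -
      define w where "w = v powr a"
      have w: "w \<ge> 0" by (simp add: w_def)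
      have e: "v powr (a - 1) * \<Psi> v = c1 * v powr (p1 + a - 1) + c2 * v powr (p2 + a - 1)"
        using v by (simp add: \<Psi> algebra_simps powr_add powr_diff)
      have "c * (1 + w)\<^sup>2 / 4 \<le> v powr (a - 1) * \<Psi> v"
      proof (cases "v \<le> 1")
        case True
        have "w \<le> 1" unfolding w_def using True v a by (simp add: powr_le_one_le powr_le1)
        then have "(1 + w)\<^sup>2 \<le> 2\<^sup>2" using w by (intro power_mono) auto
        then have "c * (1 + w)\<^sup>2 / 4 \<le> c * 1" using c' by simp
        also have "\<dots> \<le> c1 * v powr (p1 + a - 1)"
        proof (rule mult_mono)
          have "v powr 0 \<le> v powr (p1 + a - 1)" using True v a by (intro powr_mono') auto
          then show "1 \<le> v powr (p1 + a - 1)" using v by simp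
        qed (use c' in auto)
        also have "\<dots> \<le> v powr (a - 1) * \<Psi> v" unfolding e using c by simp
        finally show ?thesis .
      next
        case False
        then have "w \<ge> 1" unfolding w_def using a by (intro ge_one_powr_ge_zero) auto
        then have "(1 + w)\<^sup>2 \<le> (2 * w)\<^sup>2" by (intro power_mono) auto
        then have "c * (1 + w)\<^sup>2 / 4 \<le> c * w\<^sup>2" using c' by (simp add: power_mult_distrib)
        also have "w\<^sup>2 = v powr (2 * a)" using v by (simp add: w_def powr_power mult.commute)
        also have "c * v powr (2 * a) \<le> c2 * v powr (p2 + a - 1)"
          by (rule mult_mono) (use c' False a in \<open>auto intro: powr_mono\<close>)
        also have "\<dots> \<le> v powr (a - 1) * \<Psi> v" unfolding e using c by simp
        finally show ?thesis .
      qed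
      then have "K * a * (c * (1 + w)\<^sup>2 / 4) \<le> K * a * (v powr (a - 1) * \<Psi> v)"
        using K a by (intro mult_left_mono) auto
      also have "K * a * (c * (1 + w)\<^sup>2 / 4) = (1 + w)\<^sup>2" using a c' by (simp add: K_def)
      finally have "(1 + w)\<^sup>2 \<le> K * a * (v powr (a - 1) * \<Psi> v)" .
      moreover have "\<theta>' v * \<Psi> v = K * a * (v powr (a - 1) * \<Psi> v) / (1 + w)\<^sup>2" by (simp add: \<theta>'_def w_def)
      moreover have "(1 + w)\<^sup>2 > 0" using w by simp
      ultimately show ?thesis by (simp add: le_divide_eq)
    qed
  qed
qed

subsection \<open>Caratheodory solutions\<close>

lemma absolutely_integrable_bounded_measurable:
  fixes F :: "real \<Rightarrow> 'a::euclidean_space"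
  assumes "F \<in> borel_measurable (lebesgue_on {a..b})" "\<And>t. t \<in> {a..b} \<Longrightarrow> norm (F t) \<le> M"
  shows "F absolutely_integrable_on {a..b}"
  by (rule measurable_bounded_by_integrable_imp_absolutely_integrable[where g = "\<lambda>_. M"])
     (use assms in auto)

text \<open>The approximations freeze the state on a grid of mesh \<open>h\<close> but keep the exact input; by
  Arzela--Ascoli a subsequence converges.\<close>

lemma caratheodory_existence:
  fixes f :: "'a::euclidean_space \<Rightarrow> 'b::euclidean_space \<Rightarrow> 'a" and u :: "real \<Rightarrow> 'b"
  assumes f: "continuous_on UNIV (\<lambda>(x, v). f x v)"
    and u: "u \<in> borel_measurable (lebesgue_on {a..b})"
    and M: "\<And>x t. t \<in> {a..b} \<Longrightarrow> norm (f x (u t)) \<le> M"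
    and "a < b"
  obtains x where "continuous_on {a..b} x"
    "\<And>t. t \<in> {a..b} \<Longrightarrow> x t = x0 + integral {a..t} (\<lambda>s. f (x s) (u s))"
proof -
  have M0: "M \<ge> 0" using order_trans[OF norm_ge_zero M[of a]] \<open>a < b\<close> by simp
  have meas: "(\<lambda>s. f (z s) (u s)) \<in> borel_measurable (lebesgue_on {a..b})"
    if "z \<in> borel_measurable (lebesgue_on {a..b})" for z
    using borel_measurable_continuous_Pair[OF that u, of f] f by (simp add: case_prod_unfold)
  have int: "(\<lambda>s. f (z s) (u s)) integrable_on {a..b}"
    if "z \<in> borel_measurable (lebesgue_on {a..b})" for z
    using absolutely_integrable_bounded_measurable[OF meas[OF that] M] set_lebesgue_integral_eq_integral(1) by blast
  define h where "h n = (b - a) / real (Suc n)" for n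
  have h0: "h n > 0" for n using \<open>a < b\<close> by (simp add: h_def)
  define X where "X n = rec_nat x0 (\<lambda>j y. y + integral {a + real j * h n..a + real (Suc j) * h n} (\<lambda>s. f y (u s)))" for n
  have X0: "X n 0 = x0" and XS: "X n (Suc j) = X n j + integral {a + real j * h n..a + real (Suc j) * h n} (\<lambda>s. f (X n j) (u s))" for n j
    by (simp_all add: X_def)
  \<comment> \<open>The state held at the last grid point. Written with a floor it is Borel
    measurable, so \<open>f (z n s) (u s)\<close> is measurable for a merely measurable
    input.\<close>
  define z where "z n s = X n (nat \<lfloor>(s - a) / h n\<rfloor>)" for n s
  have zm: "z n \<in> borel_measurable (lebesgue_on {a..b})" for n
  proof -
    have "z n \<in> borel_measurable lborel"
      unfolding z_def by measurable
    then show ?thesis by (intro measurable_restrict_space1 measurable_completion)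
  qed
  define y where "y n t = x0 + integral {a..t} (\<lambda>s. f (z n s) (u s))" for n t
  have ydiff: "y n t - y n s = integral {s..t} (\<lambda>r. f (z n r) (u r))" if "a \<le> s" "s \<le> t" "t \<le> b" for n s t
  proof -
    have "(\<lambda>r. f (z n r) (u r)) integrable_on {a..t}"
      by (rule integrable_on_subinterval[OF int[OF zm]]) (use that in auto)
    from Henstock_Kurzweil_Integration.integral_combine[OF that(1,2) this] show ?thesis
      by (simp add: y_def algebra_simps)
  qed
  have ylip: "norm (y n t - y n s) \<le> M * (t - s)" if "a \<le> s" "s \<le> t" "t \<le> b" for n s t
    unfolding ydiff[OF that]
    by (rule norm_integral_le_const) (use that M in \<open>auto intro: integrable_on_subinterval[OF int[OF zm]]\<close>)
  have zconst: "z n s = X n j" if "a + real j * h n \<le> s" "s < a + real (Suc j) * h n" for n j s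
  proof -
    have "real j \<le> (s - a) / h n" "(s - a) / h n < real (Suc j)"
      using that h0[of n] by (simp_all only: le_divide_eq divide_less_eq) (simp_all add: algebra_simps)
    then have "\<lfloor>(s - a) / h n\<rfloor> = int j" by (simp add: floor_eq_iff)
    then show ?thesis by (simp add: z_def)
  qed
  have yX: "y n (a + real j * h n) = X n j" if "j \<le> Suc n" for n j
    using that
  proof (induction j)
    case 0 show ?case by (simp add: y_def X0)
  next
    case (Suc j)
    let ?s = "a + real j * h n" and ?t = "a + real (Suc j) * h n"
    have st: "a \<le> ?s" "?s \<le> ?t" using h0[of n] by (auto simp: algebra_simps)
    have "real (Suc j) * h n \<le> real (Suc n) * h n" using Suc.prems h0[of n] by (intro mult_right_mono) auto
    also have "\<dots> = b - a" by (simp add: h_def)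
    finally have tb: "?t \<le> b" by simp
    have "y n ?t - y n ?s = integral {?s..?t} (\<lambda>r. f (z n r) (u r))" by (rule ydiff[OF st tb])
    \<comment> \<open>At \<open>?t\<close> the step function already has the next grid value; one
      point does not affect the integral.\<close>
    also have "\<dots> = integral {?s..?t} (\<lambda>r. f (X n j) (u r))"
      by (rule integral_spike[of "{?t}"]) (use zconst[of j n] in \<open>auto simp: less_le\<close>)
    also have "y n ?s = X n j" using Suc by simp
    finally show ?case unfolding XS by (simp only: diff_eq_eq add.commute)
  qed
  \<comment> \<open>By \<open>yX\<close> both functions agree at the last grid point; since then
    \<open>z n\<close> has stood still and \<open>y n\<close> has moved with speed at most
    \<open>M\<close>.\<close>
  have yz: "norm (y n s - z n s) \<le> M * h n" if s: "s \<in> {a..<b}" for n s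
  proof -
    define j where "j = nat \<lfloor>(s - a) / h n\<rfloor>"
    have "(s - a) / h n \<ge> 0" using s h0[of n] by simp
    then have "real j \<le> (s - a) / h n" "(s - a) / h n < real j + 1"
      by (simp_all add: j_def)
    then have j: "real j * h n \<le> s - a" "s - a < (real j + 1) * h n"
      using h0[of n] by (simp_all add: le_divide_eq divide_less_eq)
    have "real j * h n < real (Suc n) * h n" using j(1) s by (simp add: h_def)
    then have "real j < real (Suc n)" using h0[of n] by (simp only: mult_less_cancel_right_pos)
    then have "j \<le> Suc n" by simp
    then have "z n s = y n (a + real j * h n)" by (simp add: yX z_def j_def)
    then have "norm (y n s - z n s) \<le> M * (s - (a + real j * h n))"
      using ylip[of "a + real j * h n" s n] j s h0[of n] by simp
    also have "\<dots> \<le> M * h n" using j M0 by (intro mult_left_mono) (auto simp: algebra_simps)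
    finally show ?thesis .
  qed
  have ylip': "norm (y n t - y n s) \<le> M * \<bar>t - s\<bar>" if "s \<in> {a..b}" "t \<in> {a..b}" for n s t
    using ylip[of s t n] ylip[of t s n] that by (cases "s \<le> t") (auto simp: norm_minus_commute)
  obtain x k where x: "continuous_on {a..b} x" and k: "strict_mono (k :: nat \<Rightarrow> nat)"
    and conv: "\<And>e. 0 < e \<Longrightarrow> \<exists>N. \<forall>n t. n \<ge> N \<and> t \<in> {a..b} \<longrightarrow> norm (y (k n) t - x t) < e"
  proof (rule Arzela_Ascoli[of "{a..b}" y "norm x0 + M * (b - a)"])
    fix n t assume t: "t \<in> {a..b}"
    have "norm (y n t - y n a) \<le> M * (t - a)" using ylip t by auto
    also have "\<dots> \<le> M * (b - a)" using t M0 by (intro mult_left_mono) auto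
    finally have "norm (y n t - x0) \<le> M * (b - a)" by (simp add: y_def)
    then show "norm (y n t) \<le> norm x0 + M * (b - a)" using norm_triangle_sub[of "y n t" x0] by linarith
  next
    fix t e :: real assume t: "t \<in> {a..b}" "0 < e"
    have "norm (y n t - y n s) < e" if "s \<in> {a..b}" "norm (t - s) < e / (M + 1)" for n s
    proof -
      have "norm (y n t - y n s) \<le> M * \<bar>t - s\<bar>" by (rule ylip') (use t that in auto)
      also have "\<dots> \<le> (M + 1) * \<bar>t - s\<bar>" by (intro mult_right_mono) auto
      also have "\<dots> < e" using that(2) M0 by (simp add: field_simps)
      finally show ?thesis .
    qed
    then show "\<exists>d>0. \<forall>n s. s \<in> {a..b} \<and> norm (t - s) < d \<longrightarrow> norm (y n t - y n s) < e"
      using t M0 by (intro exI[of _ "e / (M + 1)"]) (auto simp: add_nonneg_pos)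
  qed auto
  have hlim: "(\<lambda>n. h (k n)) \<longlonglongrightarrow> 0"
  proof -
    have "(\<lambda>n. (b - a) * inverse (real (Suc n))) \<longlonglongrightarrow> (b - a) * 0"
      by (intro tendsto_mult tendsto_const LIMSEQ_inverse_real_of_nat)
    then have "h \<longlonglongrightarrow> 0" by (simp add: h_def[abs_def] divide_inverse)
    then show ?thesis using LIMSEQ_subseq_LIMSEQ[OF _ k] by (simp add: o_def)
  qed
  have ylim: "(\<lambda>n. y (k n) t) \<longlonglongrightarrow> x t" if "t \<in> {a..b}" for t
    unfolding LIMSEQ_iff using conv that by blast
  have zlim: "(\<lambda>n. z (k n) s) \<longlonglongrightarrow> x s" if s: "s \<in> {a..<b}" for s
  proof -
    have "(\<lambda>n. y (k n) s - z (k n) s) \<longlonglongrightarrow> 0"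
    proof (rule Lim_null_comparison)
      show "eventually (\<lambda>n. norm (y (k n) s - z (k n) s) \<le> M * h (k n)) sequentially"
        using yz[OF s] by simp
      show "(\<lambda>n. M * h (k n)) \<longlonglongrightarrow> 0" using tendsto_mult[OF tendsto_const hlim, of M] by simp
    qed
    from tendsto_diff[OF ylim[of s] this] show ?thesis using s by simp
  qed
  show ?thesis
  proof (rule that[OF x])
    fix t assume t: "t \<in> {a..b}"
    \<comment> \<open>\<open>zlim\<close> covers \<open>{a..<b}\<close> only. Setting the integrands
      to 0 at \<open>b\<close> gives convergence at every point without changing the
      integrals.\<close>
    have "(\<lambda>n. integral {a..t} (\<lambda>s. if s = b then 0 else f (z (k n) s) (u s))) \<longlonglongrightarrow>
      integral {a..t} (\<lambda>s. if s = b then 0 else f (x s) (u s))"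
    proof (rule dominated_convergence(2)[where h = "\<lambda>_. M"])
      fix n
      have "(\<lambda>s. f (z (k n) s) (u s)) integrable_on {a..t}"
        by (rule integrable_on_subinterval[OF int[OF zm]]) (use t in auto)
      then show "(\<lambda>s. if s = b then 0 else f (z (k n) s) (u s)) integrable_on {a..t}"
        by (rule integrable_spike[of _ _ "{b}"]) auto
      show "norm (if s = b then 0 else f (z (k n) s) (u s)) \<le> M" if "s \<in> {a..t}" for s
        using M M0 t that by auto
    next
      fix s assume s: "s \<in> {a..t}"
      show "(\<lambda>n. if s = b then 0 else f (z (k n) s) (u s)) \<longlonglongrightarrow> (if s = b then 0 else f (x s) (u s))"
      proof (cases "s = b")
        case False
        then have "(\<lambda>n. (z (k n) s, u s)) \<longlonglongrightarrow> (x s, u s)"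
          using s t by (intro tendsto_Pair zlim) auto
        then have "(\<lambda>n. case (z (k n) s, u s) of (x, v) \<Rightarrow> f x v) \<longlonglongrightarrow> (case (x s, u s) of (x, v) \<Rightarrow> f x v)"
          by (rule continuous_on_tendsto_compose[OF f]) auto
        then show ?thesis using False by simp
      qed simp
    qed auto
    moreover have "integral {a..t} (\<lambda>s. if s = b then 0 else g s) = integral {a..t} g" for g :: "real \<Rightarrow> 'a"
      by (rule integral_spike[of "{b}"]) auto
    ultimately have "(\<lambda>n. y (k n) t) \<longlonglongrightarrow> x0 + integral {a..t} (\<lambda>s. f (x s) (u s))"
      unfolding y_def by (intro tendsto_add tendsto_const) simp
    with ylim[OF t] show "x t = x0 + integral {a..t} (\<lambda>s. f (x s) (u s))"
      by (rule LIMSEQ_unique)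
  qed
qed

text \<open>Solutions see the input only through integrals, so it may be altered on a null set. With
  a bound at every time the velocity along a solution is bounded on compact intervals, and the input
  thresholds can be replaced by constants.\<close>

lemma bounded_representative_of_admissible_input:
  fixes u :: "real \<Rightarrow> 'b::euclidean_space"
  assumes "admissible_input u"
  obtains u' N where "u' \<in> borel_measurable lebesgue" "\<And>t. norm (u' t) \<le> linf_norm u"
    "negligible N" "\<And>t. 0 \<le> t \<Longrightarrow> t \<notin> N \<Longrightarrow> u' t = u t"
proof -
  define c where "c = linf_norm u"
  let ?e = "esssup input_measure (\<lambda>t. ereal (norm (u t)))"
  have um: "u \<in> borel_measurable (lebesgue_on {0..})" and fin: "?e < \<infinity>"
    using assms by (simp_all add: admissible_input_def input_measure_def)
  have ae: "AE t in input_measure. ereal (norm (u t)) \<le> ?e" by (rule esssup_AE)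
  \<comment> \<open>Over a null space the essential supremum of a constant would be minus infinity.
    Positive measure gives \<open>0 \<le> ?e\<close>, so that \<open>real_of_ereal\<close> in
    \<open>linf_norm\<close> returns the true value.\<close>
  have nz: "emeasure input_measure (space input_measure) \<noteq> 0"
  proof -
    have "emeasure lebesgue {0..1::real} \<le> emeasure lebesgue {0::real..}"
      by (rule emeasure_mono) auto
    then have "emeasure lebesgue {0::real..} \<noteq> 0" by auto
    then show ?thesis by (simp add: input_measure_def emeasure_restrict_space space_restrict_space)
  qed
  have e0: "0 \<le> ?e"
  proof -
    have "esssup input_measure (\<lambda>t. 0::ereal) \<le> ?e" by (rule esssup_mono) auto
    then show ?thesis using esssup_const[OF nz, of "0::ereal"] by simp
  qed
  have ec: "?e = ereal c" unfolding c_def linf_norm_def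
    using e0 fin by (subst ereal_real) auto
  have c0: "0 \<le> c" using e0 ec by simp
  have "AE t in lebesgue_on {0..}. norm (u t) \<le> c"
    using ae unfolding ec ereal_less_eq(3) by (simp only: input_measure_def)
  then have "AE t in lebesgue. t \<in> {0..} \<longrightarrow> norm (u t) \<le> c"
    by (simp add: AE_restrict_space_iff)
  then obtain N where N: "N \<in> null_sets lebesgue" "{t. \<not> (t \<in> {0..} \<longrightarrow> norm (u t) \<le> c)} \<subseteq> N"
    by (auto simp: eventually_ae_filter)
  define v where "v t = (if t \<in> {0..} then u t else 0)" for t
  have v[measurable]: "v \<in> borel_measurable lebesgue"
    unfolding v_def by (rule borel_measurable_if_I[OF um]) simp
  define u' where "u' t = (if norm (v t) \<le> c then v t else 0)" for t
  show ?thesis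
  proof (rule that[of u' N])
    show "u' \<in> borel_measurable lebesgue" unfolding u'_def by measurable
    show "norm (u' t) \<le> linf_norm u" for t using c0 by (simp add: u'_def c_def)
    show "negligible N" using N by (simp add: negligible_iff_null_sets)
    show "u' t = u t" if "0 \<le> t" "t \<notin> N" for t using that N(2) by (auto simp: u'_def v_def)
  qed
qed

lemma linf_norm_nonneg:
  fixes u :: "real \<Rightarrow> 'b::euclidean_space"
  assumes "admissible_input u"
  shows "0 \<le> linf_norm u"
  using bounded_representative_of_admissible_input[OF assms] norm_ge_zero order_trans by metis

lemma is_solution_AE_cong:
  fixes f :: "'a::euclidean_space \<Rightarrow> 'b \<Rightarrow> 'a"
  assumes "negligible N" "\<And>t. 0 \<le> t \<Longrightarrow> t \<notin> N \<Longrightarrow> u' t = u t"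
  shows "is_solution f u x0 I x \<longleftrightarrow> is_solution f u' x0 I x"
proof -
  have "(\<lambda>s. f (x s) (u s)) absolutely_integrable_on {0..t} \<longleftrightarrow> (\<lambda>s. f (x s) (u' s)) absolutely_integrable_on {0..t}"
    and "integral {0..t} (\<lambda>s. f (x s) (u s)) = integral {0..t} (\<lambda>s. f (x s) (u' s))" for t
    using assms by (auto intro!: absolutely_integrable_spike_eq[of N] integral_spike[of N])
  then show ?thesis by (simp add: is_solution_def)
qed

lemma is_solutionD:
  assumes "is_solution f u x0 I x"
  shows "x 0 = x0" "t \<in> I \<Longrightarrow> (\<lambda>s. f (x s) (u s)) absolutely_integrable_on {0..t}"
    "t \<in> I \<Longrightarrow> x t = x0 + integral {0..t} (\<lambda>s. f (x s) (u s))"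
  using assms unfolding is_solution_def by blast+

lemma is_solution_subset: "is_solution f u x0 I x \<Longrightarrow> J \<subseteq> I \<Longrightarrow> is_solution f u x0 J x"
  by (auto simp: is_solution_def)

text \<open>Causality: both solution clauses at time \<open>t\<close> depend only on the values up
  to \<open>t\<close>. This is what allows solutions to be pasted together.\<close>

lemma is_solution_agree:
  fixes f :: "'a::euclidean_space \<Rightarrow> 'b \<Rightarrow> 'a"
  assumes "is_solution f u x0 I x" "t \<in> I" "0 \<le> t" "\<And>s. 0 \<le> s \<Longrightarrow> s \<le> t \<Longrightarrow> y s = x s"
  shows "(\<lambda>s. f (y s) (u s)) absolutely_integrable_on {0..t}"
    "y t = x0 + integral {0..t} (\<lambda>s. f (y s) (u s))"
proof -
  have *: "(\<lambda>s. f (x s) (u s)) absolutely_integrable_on {0..t}"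
    "x t = x0 + integral {0..t} (\<lambda>s. f (x s) (u s))"
    using is_solutionD(2,3)[OF assms(1,2)] by blast+
  show "(\<lambda>s. f (y s) (u s)) absolutely_integrable_on {0..t}"
    by (rule absolutely_integrable_spike[OF *(1), of "{}"]) (use assms(4) in auto)
  have "integral {0..t} (\<lambda>s. f (y s) (u s)) = integral {0..t} (\<lambda>s. f (x s) (u s))"
    by (rule integral_cong) (use assms(4) in auto)
  then show "y t = x0 + integral {0..t} (\<lambda>s. f (y s) (u s))"
    using *(2) assms(4)[OF assms(3) order_refl] by simp
qed

lemma is_solution_continuous_on:
  fixes f :: "'a::euclidean_space \<Rightarrow> 'b \<Rightarrow> 'a"
  assumes "is_solution f u x0 {0..b} x"
  shows "continuous_on {0..b} x"
proof (cases "0 \<le> b")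
  case True
  then have "(\<lambda>s. f (x s) (u s)) integrable_on {0..b}"
    using is_solutionD(2)[OF assms, of b] set_lebesgue_integral_eq_integral(1) by auto
  then have "continuous_on {0..b} (\<lambda>t. x0 + integral {0..t} (\<lambda>s. f (x s) (u s)))"
    by (intro continuous_intros indefinite_integral_continuous_1)
  then show ?thesis
    by (rule continuous_on_eq) (rule is_solutionD(3)[OF assms, symmetric])
qed simp

section \<open>Continuation of bounded solutions\<close>

lemma bounded_on_cballs:
  fixes f :: "'a::euclidean_space \<Rightarrow> 'b::euclidean_space \<Rightarrow> 'a"
  assumes f: "continuous_on UNIV (\<lambda>(x, v). f x v)"
  obtains M where "M \<ge> 0" "\<And>x v. norm x \<le> R \<Longrightarrow> norm v \<le> c \<Longrightarrow> norm (f x v) \<le> M"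
proof -
  have "bounded ((\<lambda>(x, v). f x v) ` (cball 0 R \<times> cball 0 c))"
    by (intro compact_imp_bounded compact_continuous_image compact_Times compact_cball continuous_on_subset[OF f]) auto
  then obtain M where "\<forall>z\<in>(\<lambda>(x, v). f x v) ` (cball 0 R \<times> cball 0 c). norm z \<le> M" by (auto simp: bounded_iff)
  then have "norm (f x v) \<le> max M 0" if "norm x \<le> R" "norm v \<le> c" for x v
    using that by (force simp: max.coboundedI1)
  then show ?thesis by (intro that[of "max M 0"]) auto
qed

text \<open>\<open>S\<close> is a general set because one use is on \<open>{0..<T}\<close>, before
  anything is known about the solution at \<open>T\<close>.\<close>

lemma absolutely_integrable_along_continuous:
  fixes f :: "'a::euclidean_space \<Rightarrow> 'b::euclidean_space \<Rightarrow> 'a"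
  assumes f: "continuous_on UNIV (\<lambda>(x, v). f x v)"
    and u: "u \<in> borel_measurable lebesgue" "\<And>t. norm (u t) \<le> c"
    and x: "continuous_on S x" "\<And>t. t \<in> S \<Longrightarrow> norm (x t) \<le> R"
    and S: "S \<in> lmeasurable"
  shows "(\<lambda>s. f (x s) (u s)) absolutely_integrable_on S"
proof -
  obtain M where M: "\<And>x v. norm x \<le> R \<Longrightarrow> norm v \<le> c \<Longrightarrow> norm (f x v) \<le> M"
    using bounded_on_cballs[OF f] by metis
  have "x \<in> borel_measurable (lebesgue_on S)"
    by (rule continuous_imp_measurable_on_sets_lebesgue[OF x(1)]) (use S in \<open>auto simp: fmeasurableD\<close>)
  moreover have "u \<in> borel_measurable (lebesgue_on S)" using u(1) by (rule measurable_restrict_space1)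
  ultimately have "(\<lambda>s. f (x s) (u s)) \<in> borel_measurable (lebesgue_on S)"
    by (rule borel_measurable_continuous_Pair) (use f in \<open>simp add: case_prod_unfold\<close>)
  then show ?thesis
    by (rule measurable_bounded_by_integrable_imp_absolutely_integrable[where g = "\<lambda>_. M"])
       (use S M u(2) x(2) in \<open>auto simp: fmeasurableD integrable_on_const\<close>)
qed

text \<open>A bounded solution has bounded velocity, which is integrable up to \<open>T\<close>, so
  the integral formula itself supplies the missing end value. Whatever \<open>x T\<close> happens to
  be, it affects the integrand at a single point.\<close>

lemma is_solution_close:
  fixes f :: "'a::euclidean_space \<Rightarrow> 'b::euclidean_space \<Rightarrow> 'a"
  assumes f: "continuous_on UNIV (\<lambda>(x, v). f x v)"
    and u: "u \<in> borel_measurable lebesgue" "\<And>t. norm (u t) \<le> c"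
    and "T > 0" and x: "is_solution f u x0 {0..<T} x" "\<And>t. t \<in> {0..<T} \<Longrightarrow> norm (x t) \<le> R"
  obtains y where "is_solution f u x0 {0..T} y" "\<And>t. t \<in> {0..<T} \<Longrightarrow> y t = x t"
proof -
  have contx: "continuous_on {0..<T} x"
    unfolding continuous_on_eq_continuous_within
  proof
    fix t assume t: "t \<in> {0..<T}"
    then obtain b where b: "t < b" "b < T" using dense by auto
    have "{0..b} \<subseteq> {0..<T}" using b by auto
    then have "continuous_on {0..b} x"
      by (rule is_solution_continuous_on[OF is_solution_subset[OF x(1)]])
    then have "continuous (at t within {0..b}) x"
      using t b by (simp add: continuous_on_eq_continuous_within)
    moreover have "at t within {0..b} = at t within {0..<T}"
      by (rule at_within_nhd[of _ "{..<b}"]) (use t b in auto)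
    ultimately show "continuous (at t within {0..<T}) x" by simp
  qed
  have "(\<lambda>s. f (x s) (u s)) absolutely_integrable_on {0..<T}"
  proof (rule absolutely_integrable_along_continuous[OF f u contx x(2)])
    have "bounded {0..<T}" by (rule bounded_subset[of "{0..T}"]) auto
    then show "{0..<T} \<in> lmeasurable" by (rule bounded_set_imp_lmeasurable) simp
  qed
  then have FT: "(\<lambda>s. f (x s) (u s)) absolutely_integrable_on {0..T}"
    by (rule iffD1[OF absolutely_integrable_spike_set_eq, rotated 2])
       (auto intro: negligible_subset[of "{T}"])
  define y where "y t = x0 + integral {0..t} (\<lambda>s. f (x s) (u s))" for t
  have yx: "y t = x t" if "t \<in> {0..<T}" for t unfolding y_def by (rule is_solutionD(3)[OF x(1) that, symmetric])
  show ?thesis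
  proof (rule that[OF _ yx])
    show "is_solution f u x0 {0..T} y"
      unfolding is_solution_def
    proof (intro conjI ballI)
      show "y 0 = x0" by (simp add: y_def)
      fix t assume t: "t \<in> {0..T}"
      have "(\<lambda>s. f (x s) (u s)) absolutely_integrable_on {0..t}"
        by (rule absolutely_integrable_on_subinterval[OF FT]) (use t in auto)
      then show "(\<lambda>s. f (y s) (u s)) absolutely_integrable_on {0..t}"
        by (rule absolutely_integrable_spike[of _ _ "{T}"]) (use t yx in auto)
      have "integral {0..t} (\<lambda>s. f (y s) (u s)) = integral {0..t} (\<lambda>s. f (x s) (u s))"
        by (rule integral_spike[of "{T}"]) (use t yx in auto)
      then show "y t = x0 + integral {0..t} (\<lambda>s. f (y s) (u s))" by (simp add: y_def)
    qed
  qed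
qed

text \<open>\<open>\<delta>\<close> depends on \<open>R\<close> and \<open>c\<close> only, so the
  step can be repeated without shrinking. Composing \<open>f\<close> with the projection
  \<open>p\<close> onto the ball of radius \<open>R + 1\<close> gives a globally bounded field, as
  local existence demands; its solution moves by at most \<open>M * \<delta> \<le> 1\<close>, hence
  stays in that ball, where \<open>p\<close> is the identity.\<close>

lemma is_solution_extend:
  fixes f :: "'a::euclidean_space \<Rightarrow> 'b::euclidean_space \<Rightarrow> 'a"
  assumes f: "continuous_on UNIV (\<lambda>(x, v). f x v)"
    and u: "u \<in> borel_measurable lebesgue" "\<And>t. norm (u t) \<le> c" and "R \<ge> 0"
  obtains \<delta> where "\<delta> > 0" "\<And>S x x0. S \<ge> 0 \<Longrightarrow> is_solution f u x0 {0..S} x \<Longrightarrow> (\<And>t. t \<in> {0..S} \<Longrightarrow> norm (x t) \<le> R) \<Longrightarrow>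
      \<exists>y. is_solution f u x0 {0..S+\<delta>} y \<and> (\<forall>t\<in>{0..S}. y t = x t)"
proof -
  obtain M where "M \<ge> 0" and M: "\<And>x v. norm x \<le> R + 1 \<Longrightarrow> norm v \<le> c \<Longrightarrow> norm (f x v) \<le> M"
    using bounded_on_cballs[OF f] by metis
  define \<delta> where "\<delta> = 1 / (M + 1)"
  have \<delta>: "\<delta> > 0" "M * \<delta> \<le> 1" using \<open>M \<ge> 0\<close> by (auto simp: \<delta>_def add_nonneg_pos)
  define p where "p = closest_point (cball (0::'a) (R + 1))"
  have ne: "cball (0::'a) (R + 1) \<noteq> {}" using \<open>R \<ge> 0\<close> by auto
  have contp: "continuous_on S p" for S
    unfolding p_def by (rule continuous_on_closest_point) (use ne in auto)
  have pin: "norm (p z) \<le> R + 1" for z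
    using closest_point_in_set[of "cball (0::'a) (R + 1)" z] ne by (simp add: p_def)
  have pid: "p z = z" if "norm z \<le> R + 1" for z
    unfolding p_def by (rule closest_point_self) (use that in auto)
  have fp: "continuous_on UNIV (\<lambda>(x, v). f (p x) v)"
  proof -
    have "continuous_on UNIV (\<lambda>w. (p (fst w), snd w :: 'b))"
      by (intro continuous_intros continuous_on_compose2[OF contp[of UNIV]]) auto
    from continuous_on_compose2[OF f this] show ?thesis by (simp add: case_prod_unfold)
  qed
  have "\<exists>y. is_solution f u x0 {0..S+\<delta>} y \<and> (\<forall>t\<in>{0..S}. y t = x t)"
    if "S \<ge> 0" and x: "is_solution f u x0 {0..S} x" and xR: "\<And>t. t \<in> {0..S} \<Longrightarrow> norm (x t) \<le> R" for S x x0
  proof -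
    obtain z where contz: "continuous_on {S..S+\<delta>} z"
      and z: "\<And>t. t \<in> {S..S+\<delta>} \<Longrightarrow> z t = x S + integral {S..t} (\<lambda>s. f (p (z s)) (u s))"
      by (rule caratheodory_existence[OF fp, of u S "S+\<delta>" M "x S"])
         (use u \<delta> M pin in \<open>auto intro: measurable_restrict_space1\<close>)
    have intz: "(\<lambda>s. f (p (z s)) (u s)) integrable_on {S..S+\<delta>}"
      by (rule set_lebesgue_integral_eq_integral(1),
          rule absolutely_integrable_along_continuous[OF f u, of _ _ "R+1"])
         (use pin contz contp in \<open>auto intro: continuous_on_compose2[OF contp[of UNIV]]\<close>)
    have zR: "norm (z t) \<le> R + 1" if t: "t \<in> {S..S+\<delta>}" for t
    proof -
      have "norm (integral {S..t} (\<lambda>s. f (p (z s)) (u s))) \<le> M * (t - S)"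
        by (rule norm_integral_le_const) (use t M pin u in \<open>auto intro: integrable_on_subinterval[OF intz]\<close>)
      also have "\<dots> \<le> M * \<delta>" using t \<open>M \<ge> 0\<close> by (intro mult_left_mono) auto
      also have "\<dots> \<le> 1" by (rule \<delta>)
      finally show ?thesis using xR[of S] \<open>S \<ge> 0\<close> norm_triangle_ineq[of "x S" "integral {S..t} (\<lambda>s. f (p (z s)) (u s))"]
        by (simp add: z[OF t])
    qed
    define w where "w t = (if t \<le> S then x t else z t)" for t
    have zS: "z S = x S" using z[of S] \<delta> by simp
    have wz: "w t = z t" if "t \<ge> S" for t using that zS by (auto simp: w_def)
    have contw: "continuous_on {0..S+\<delta>} w" unfolding w_def
    proof (rule continuous_on_cases_1)
      show "continuous_on {t \<in> {0..S+\<delta>}. t \<le> S} x"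
        by (rule continuous_on_subset[OF is_solution_continuous_on[OF x]]) auto
      show "continuous_on {t \<in> {0..S+\<delta>}. S \<le> t} z"
        by (rule continuous_on_subset[OF contz]) auto
    qed (simp add: zS)
    have wR: "norm (w t) \<le> R + 1" if "t \<in> {0..S+\<delta>}" for t
      using that xR[of t] zR[of t] by (auto simp: w_def)
    have "is_solution f u x0 {0..S+\<delta>} w"
      unfolding is_solution_def
    proof (intro conjI ballI)
      show "w 0 = x0" using is_solutionD(1)[OF x] \<open>S \<ge> 0\<close> by (simp add: w_def)
      fix t assume t: "t \<in> {0..S+\<delta>}"
      show ai: "(\<lambda>s. f (w s) (u s)) absolutely_integrable_on {0..t}"
        by (rule absolutely_integrable_along_continuous[OF f u, of _ _ "R+1"])
           (use t wR in \<open>auto intro: continuous_on_subset[OF contw]\<close>)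
      show "w t = x0 + integral {0..t} (\<lambda>s. f (w s) (u s))"
      proof (cases "t \<le> S")
        case True
        then show ?thesis
          using t by (intro is_solution_agree(2)[OF x]) (auto simp: w_def)
      next
        case False
        have "x S = x0 + integral {0..S} (\<lambda>s. f (w s) (u s))"
          using is_solution_agree(2)[OF x, of S w] \<open>S \<ge> 0\<close> by (simp add: w_def)
        moreover have "integral {S..t} (\<lambda>s. f (w s) (u s)) = integral {S..t} (\<lambda>s. f (p (z s)) (u s))"
          using t by (intro integral_cong) (auto simp: wz pid zR)
        moreover have "integral {0..S} (\<lambda>s. f (w s) (u s)) + integral {S..t} (\<lambda>s. f (w s) (u s)) = integral {0..t} (\<lambda>s. f (w s) (u s))"
          by (rule Henstock_Kurzweil_Integration.integral_combine)
             (use False \<open>S \<ge> 0\<close> ai set_lebesgue_integral_eq_integral(1) in auto)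
        moreover have "w t = x S + integral {S..t} (\<lambda>s. f (p (z s)) (u s))"
          using wz[of t] z[of t] False t by auto
        ultimately show ?thesis by (simp add: add.assoc)
      qed
    qed
    then show ?thesis by (intro exI[of _ w]) (auto simp: w_def)
  qed
  then show ?thesis using that \<delta> by blast
qed

text \<open>The bound \<open>R\<close> holds for all solutions on compact intervals, thus also for
  every extension already made; the same step length stays available and
  \<open>T + n * \<delta>\<close> passes every time.\<close>

lemma is_solution_global:
  fixes f :: "'a::euclidean_space \<Rightarrow> 'b::euclidean_space \<Rightarrow> 'a"
  assumes f: "continuous_on UNIV (\<lambda>(x, v). f x v)"
    and u: "u \<in> borel_measurable lebesgue" "\<And>t. norm (u t) \<le> c"
    and R: "\<And>S y t. S \<ge> 0 \<Longrightarrow> is_solution f u x0 {0..S} y \<Longrightarrow> t \<in> {0..S} \<Longrightarrow> norm (y t) \<le> R"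
    and "T > 0" and x: "is_solution f u x0 {0..<T} x"
  shows "\<exists>y. is_solution f u x0 {0..} y \<and> (\<forall>t\<in>{0..<T}. y t = x t)"
proof -
  have xR: "norm (x t) \<le> R" if "t \<in> {0..<T}" for t
  proof -
    have "{0..t} \<subseteq> {0..<T}" using that by auto
    from R[OF _ is_solution_subset[OF x this], of t] show ?thesis using that by simp
  qed
  have "R \<ge> 0" using order_trans[OF norm_ge_zero xR[of 0]] \<open>T > 0\<close> by simp
  obtain y0 where y0: "is_solution f u x0 {0..T} y0" "\<And>t. t \<in> {0..<T} \<Longrightarrow> y0 t = x t"
    using is_solution_close[OF f u \<open>T > 0\<close> x xR] by blast
  obtain \<delta> where "\<delta> > 0" and ext: "\<And>S x x0. S \<ge> 0 \<Longrightarrow> is_solution f u x0 {0..S} x \<Longrightarrow> (\<And>t. t \<in> {0..S} \<Longrightarrow> norm (x t) \<le> R) \<Longrightarrow>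
      \<exists>y. is_solution f u x0 {0..S+\<delta>} y \<and> (\<forall>t\<in>{0..S}. y t = x t)"
    using is_solution_extend[OF f u \<open>R \<ge> 0\<close>] by blast
  define \<tau> where "\<tau> n = T + real n * \<delta>" for n
  have \<tau>: "\<tau> n \<ge> 0" "\<tau> (Suc n) = \<tau> n + \<delta>" for n using \<open>T > 0\<close> \<open>\<delta> > 0\<close> by (auto simp: \<tau>_def algebra_simps)
  \<comment> \<open>Without uniqueness the extensions have to be chosen coherently, each from its
    predecessor; the clause for \<open>n = 0\<close> ties the sequence to the given
    solution.\<close>
  have "\<exists>Y. \<forall>n. (is_solution f u x0 {0..\<tau> n} (Y n) \<and> (n = 0 \<longrightarrow> Y n = y0)) \<and> (\<forall>t\<in>{0..\<tau> n}. Y (Suc n) t = Y n t)"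
  proof (rule dependent_nat_choice)
    show "\<exists>y. is_solution f u x0 {0..\<tau> 0} y \<and> ((0::nat) = 0 \<longrightarrow> y = y0)" using y0 by (auto simp: \<tau>_def)
    fix y n assume "is_solution f u x0 {0..\<tau> n} y \<and> (n = 0 \<longrightarrow> y = y0)"
    then show "\<exists>y'. (is_solution f u x0 {0..\<tau> (Suc n)} y' \<and> (Suc n = 0 \<longrightarrow> y' = y0)) \<and> (\<forall>t\<in>{0..\<tau> n}. y' t = y t)"
      using ext[OF \<tau>(1), of x0 n y] R[OF \<tau>(1), of n y] by (simp add: \<tau>(2))
  qed
  then obtain Y where Y: "\<And>n. is_solution f u x0 {0..\<tau> n} (Y n)" and Y0: "Y 0 = y0"
    and YS: "\<And>n t. t \<in> {0..\<tau> n} \<Longrightarrow> Y (Suc n) t = Y n t" by blast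
  have mono: "\<tau> n \<le> \<tau> m" if "n \<le> m" for n m
    using that \<open>\<delta> > 0\<close> by (auto simp: \<tau>_def intro: mult_right_mono)
  have Yeq: "Y m t = Y n t" if "n \<le> m" "0 \<le> t" "t \<le> \<tau> n" for n m t
    using that(1)
  proof (induction m rule: dec_induct)
    case (step m)
    then show ?case using YS[of t m] mono[of n m] that by auto
  qed simp
  \<comment> \<open>Some index whose interval contains \<open>t\<close>; by \<open>yY\<close> any
    other such index yields the same value.\<close>
  define k where "k t = nat \<lceil>t / \<delta>\<rceil>" for t
  have k: "t \<le> \<tau> (k t)" for t
  proof -
    have "t / \<delta> \<le> real (k t)" unfolding k_def by linarith
    then have "t \<le> real (k t) * \<delta>" using \<open>\<delta> > 0\<close> by (simp add: divide_le_eq)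
    then show ?thesis using \<open>T > 0\<close> by (simp add: \<tau>_def)
  qed
  define y where "y t = Y (k t) t" for t
  have yY: "y t = Y n t" if "0 \<le> t" "t \<le> \<tau> n" for t n
    using Yeq[of n "k t" t] Yeq[of "k t" n t] that k[of t] by (cases "n \<le> k t") (auto simp: y_def)
  show ?thesis
  proof (intro exI[of _ y] conjI ballI)
    show "is_solution f u x0 {0..} y"
      unfolding is_solution_def
    proof (intro conjI ballI)
      show "y 0 = x0" using is_solutionD(1)[OF Y[of 0]] yY[of 0 0] \<tau>(1)[of 0] by simp
      fix t :: real assume t: "t \<in> {0..}"
      have *: "y s = Y (k t) s" if "0 \<le> s" "s \<le> t" for s
        using yY[of s "k t"] k[of t] that by simp
      have "t \<in> {0..\<tau> (k t)}" "0 \<le> t" using t k by auto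
      note agree = is_solution_agree[OF Y this]
      show "(\<lambda>s. f (y s) (u s)) absolutely_integrable_on {0..t}" by (rule agree(1)) (rule *)
      show "y t = x0 + integral {0..t} (\<lambda>s. f (y s) (u s))" by (rule agree(2)) (rule *)
    qed
    fix t assume "t \<in> {0..<T}"
    then show "y t = x t" using yY[of t 0] y0(2)[of t] Y0 by (simp add: \<tau>_def)
  qed
qed

subsection \<open>The small-gain estimate\<close>

lemma is_solution_trajectory:
  fixes f :: "'a::euclidean_space \<Rightarrow> 'b::euclidean_space \<Rightarrow> 'a"
  assumes f: "continuous_on UNIV (\<lambda>(x, v). f x v)" and u: "\<And>t. norm (u t) \<le> c"
    and "0 \<le> S" and x: "is_solution f u x0 {0..S} x"
  shows "trajectory 0 S (\<lambda>s. f (x s) (u s)) x"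
  unfolding trajectory_def
proof (intro conjI allI impI)
  have int: "(\<lambda>s. f (x s) (u s)) integrable_on {0..S}"
    using is_solutionD(2)[OF x, of S] \<open>0 \<le> S\<close> set_lebesgue_integral_eq_integral(1) by auto
  then show "(\<lambda>s. f (x s) (u s)) integrable_on {0..S}" .
  have "bounded (x ` {0..S})"
    by (intro compact_imp_bounded compact_continuous_image is_solution_continuous_on[OF x]) auto
  then obtain R where R: "\<And>t. t \<in> {0..S} \<Longrightarrow> norm (x t) \<le> R" unfolding bounded_iff by blast
  obtain M where "\<And>y v. norm y \<le> R \<Longrightarrow> norm v \<le> c \<Longrightarrow> norm (f y v) \<le> M"
    using bounded_on_cballs[OF f] by metis
  then show "bounded ((\<lambda>s. f (x s) (u s)) ` {0..S})" using R u unfolding bounded_iff by blast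
  fix s t assume st: "0 \<le> s" "s \<le> t" "t \<le> S"
  have "integral {0..s} (\<lambda>s. f (x s) (u s)) + integral {s..t} (\<lambda>s. f (x s) (u s)) = integral {0..t} (\<lambda>s. f (x s) (u s))"
    by (rule Henstock_Kurzweil_Integration.integral_combine[OF st(1,2)])
       (rule integrable_on_subinterval[OF int], use st in auto)
  then show "x t - x s = integral {s..t} (\<lambda>s. f (x s) (u s))"
    using is_solutionD(3)[OF x, of s] is_solutionD(3)[OF x, of t] st
    by (metis (no_types, lifting) add_diff_cancel_left add_diff_cancel_left' atLeastAtMost_iff order_trans)
qed

text \<open>After the last time \<open>r\<close> with \<open>e r \<le> c\<close>, \<open>loc\<close>
  applies throughout and \<open>e s + s\<close> does not increase, whence
  \<open>e t \<le> c - (t - r)\<close>. If there is no such time, the same comparison starts at 0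
  and gives \<open>e 0 - t\<close>.\<close>

lemma level_decrease:
  fixes e :: "real \<Rightarrow> real"
  assumes cont: "continuous_on {0..S} e" and t: "t \<in> {0..S}"
    and loc: "\<And>t. 0 \<le> t \<Longrightarrow> t < S \<Longrightarrow> c < e t \<Longrightarrow> \<exists>h>0. \<forall>s\<in>{t..t+h}. s \<le> S \<longrightarrow> e s \<le> e t - (s - t)"
  shows "e t \<le> max (e 0 - t) c"
proof (rule ccontr)
  assume neg: "\<not> ?thesis"
  have contg: "continuous_on {r..t} (\<lambda>s. e s + s)" if "0 \<le> r" for r
    by (intro continuous_intros continuous_on_subset[OF cont]) (use that t in auto)
  \<comment> \<open>At \<open>r\<close> itself \<open>e r \<le> c\<close> is possible, where
    \<open>loc\<close> is silent. The comparison therefore starts at each \<open>s > r\<close> and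
    reaches \<open>r\<close> by continuity from the right.\<close>
  have dec: "e t + t \<le> e r + r" if r: "0 \<le> r" "r \<le> t" and above: "\<And>s. r < s \<Longrightarrow> s \<le> t \<Longrightarrow> c < e s" for r
  proof (cases "r = t")
    case False
    have le: "e t + t \<le> e s + s" if "s \<in> {r<..<t}" for s
    proof (rule local_nonincreasing_imp_le[OF _ contg])
      fix p assume p: "s \<le> p" "p < t"
      then have "0 \<le> p" "p < S" "c < e p" using above[of p] that t r by auto
      then obtain h where h: "h > 0" "\<forall>s\<in>{p..p+h}. s \<le> S \<longrightarrow> e s \<le> e p - (s - p)"
        using loc by blast
      have "e q + q \<le> e p + p" if "q \<in> {p..p+h}" "q \<le> t" for q
        using bspec[OF h(2) that(1)] that(2) t by simp
      then show "\<exists>h>0. \<forall>s\<in>{p..p + h}. s \<le> t \<longrightarrow> e s + s \<le> e p + p" using h(1) by blast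
    qed (use that r in auto)
    have rt: "r < t" using r False by simp
    have "((\<lambda>s. e s + s) \<longlongrightarrow> e r + r) (at_right r)"
      by (rule continuous_on_Icc_at_rightD[OF contg[OF r(1)] rt])
    then show ?thesis
    proof (rule tendsto_lowerbound)
      show "eventually (\<lambda>s. e t + t \<le> e s + s) (at_right r)"
        unfolding eventually_at_right_field using rt le by (intro exI[of _ t]) auto
    qed simp
  qed simp
  define Z where "Z = {s \<in> {0..t}. e s \<le> c}"
  show False
  proof (cases "Z = {}")
    case True
    then have "c < e s" if "0 < s" "s \<le> t" for s using that by (force simp: Z_def)
    then have "e t + t \<le> e 0 + 0" using t by (intro dec) auto
    then show False using neg by simp
  next
    case False
    have "Z = {0..t} \<inter> e -` {..c}" by (auto simp: Z_def)
    moreover have "continuous_on {0..t} e" by (rule continuous_on_subset[OF cont]) (use t in auto)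
    ultimately have "closed Z" using continuous_closed_preimage[of "{0..t}" e "{..c}"] by simp
    have bdd: "bdd_above Z" by (auto simp: Z_def bdd_above_def)
    define r where "r = Sup Z"
    have "r \<in> Z" unfolding r_def by (rule closed_contains_Sup[OF False bdd \<open>closed Z\<close>])
    then have r: "0 \<le> r" "r \<le> t" "e r \<le> c" by (auto simp: Z_def)
    have "c < e s" if "r < s" "s \<le> t" for s
    proof (rule ccontr)
      assume "\<not> c < e s"
      then have "s \<in> Z" using that r by (auto simp: Z_def)
      then show False using cSup_upper[OF _ bdd] that by (force simp: r_def)
    qed
    then have "e t + t \<le> e r + r" by (intro dec r)
    then show False using neg r by simp
  qed
qed

lemma continuous_less_persists:
  fixes f g :: "real \<Rightarrow> real"
  assumes "continuous_on {a..b} f" "continuous_on {a..b} g" "a \<le> t" "t < b" "g t < f t"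
  shows "\<exists>h>0. \<forall>s\<in>{t..t+h}. s \<le> b \<longrightarrow> g s < f s"
proof -
  have "continuous_on {a..b} (\<lambda>s. f s - g s)" by (intro continuous_intros assms)
  moreover have "t \<in> {a..b}" "0 < f t - g t" using assms by auto
  ultimately obtain d where d: "d > 0"
    and dd: "\<forall>s\<in>{a..b}. dist s t < d \<longrightarrow> dist (f s - g s) (f t - g t) < f t - g t"
    unfolding continuous_on_iff by blast
  have "g s < f s" if "s \<in> {t..t+d/2}" "s \<le> b" for s
  proof -
    have "s \<in> {a..b}" "dist s t < d" using that \<open>a \<le> t\<close> d by (auto simp: dist_real_def)
    with dd have "dist (f s - g s) (f t - g t) < f t - g t" by blast
    then show ?thesis by (auto simp: dist_real_def abs_if split: if_splits)
  qed
  then show ?thesis using d by (intro exI[of _ "d/2"]) auto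
qed

text \<open>By continuity the strict inequality at \<open>t\<close> persists for a short time,
  during which the decrease condition holds throughout. \<open>q\<close> is nonnegative, so
  \<open>V\<close> is positive there, as \<open>lyapunov_decrease\<close> requires.\<close>

lemma gain_decrease:
  fixes x F :: "real \<Rightarrow> 'a::euclidean_space" and V :: "'a \<Rightarrow> real"
  assumes traj: "trajectory a b F x" and V: "locally_lipschitz V" and q: "continuous_on {a..b} q"
    and q0: "\<And>s. s \<in> {a..b} \<Longrightarrow> 0 \<le> q s"
    and decr: "\<And>s. s \<in> {a..b} \<Longrightarrow> q s \<le> V (x s) \<Longrightarrow> dini_deriv V (x s) (F s) \<le> ereal (- \<Psi> (V (x s)))"
    and settling: "settling_function \<Psi> \<theta>" and t: "a \<le> t" "t < b" "q t < V (x t)"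
  shows "\<exists>h>0. \<forall>s\<in>{t..t+h}. s \<le> b \<longrightarrow> \<theta> (V (x s)) \<le> \<theta> (V (x t)) - (s - t)"
proof -
  have contV: "continuous_on {a..b} (\<lambda>s. V (x s))"
    by (rule continuous_on_compose2[OF locally_lipschitz_imp_continuous_on[OF V] trajectory_continuous_on[OF traj], of UNIV]) auto
  obtain d where d: "d > 0" and above: "\<And>s. s \<in> {t..t+d} \<Longrightarrow> s \<le> b \<Longrightarrow> q s < V (x s)"
    using continuous_less_persists[OF contV q t] by blast
  have "\<theta> (V (x s)) \<le> \<theta> (V (x t)) - (s - t)" if s: "s \<in> {t..t+d}" "s \<le> b" for s
  proof (rule lyapunov_decrease[OF _ _ V _ _ settling])
    show "t \<le> s" using s by simp
    show "trajectory t s F x" by (rule trajectory_subinterval[OF traj]) (use s t in auto)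
    fix r assume r: "r \<in> {t..s}"
    then have ab: "r \<in> {a..b}" using s t by auto
    have *: "q r < V (x r)" by (rule above) (use r s in auto)
    then show "0 < V (x r)" using q0[OF ab] by simp
    show "dini_deriv V (x r) (F r) \<le> ereal (- \<Psi> (V (x r)))" by (rule decr[OF ab]) (use * in simp)
  qed
  then show ?thesis using d by blast
qed

text \<open>\<open>max k1 (\<sigma> k2)\<close> is the level above which the dominating function
  exceeds its own input threshold. The inequalities \<open>gap\<close> let it exceed the gain of the
  other function too: \<open>gam1 (v2) \<le> \<sigma> (v2) < v1\<close> in one case,
  \<open>gam2 (v1) \<le> gam2 (\<sigma> (v2)) < v2\<close> in the other.\<close>

lemma small_gain_estimate:
  fixes x F :: "real \<Rightarrow> 'a::euclidean_space \<times> 'b::euclidean_space"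
  assumes traj: "trajectory 0 S F x"
    and V1: "locally_lipschitz V1" "\<And>y. 0 \<le> V1 y" and V2: "locally_lipschitz V2" "\<And>y. 0 \<le> V2 y"
    and gam: "class_K gam1" "class_K gam2"
    and settling: "settling_function \<Psi>1 \<theta>1" "settling_function \<Psi>2 \<theta>2"
    and decr1: "\<And>s. s \<in> {0..S} \<Longrightarrow> max (gam1 (V2 (snd (x s)))) k1 \<le> V1 (fst (x s)) \<Longrightarrow>
       dini_deriv V1 (fst (x s)) (fst (F s)) \<le> ereal (- \<Psi>1 (V1 (fst (x s))))"
    and decr2: "\<And>s. s \<in> {0..S} \<Longrightarrow> max (gam2 (V1 (fst (x s)))) k2 \<le> V2 (snd (x s)) \<Longrightarrow>
       dini_deriv V2 (snd (x s)) (snd (F s)) \<le> ereal (- \<Psi>2 (V2 (snd (x s))))"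
    and k: "0 \<le> k1" "0 \<le> k2"
    and \<sigma>: "class_K \<sigma>" "class_K \<sigma>i" "\<And>s. 0 \<le> s \<Longrightarrow> \<sigma>i (\<sigma> s) = s"
    and gap: "\<And>s. 0 < s \<Longrightarrow> gam1 s < \<sigma> s" "\<And>s. 0 < s \<Longrightarrow> gam2 (\<sigma> s) < s"
    and t: "t \<in> {0..S}"
  defines "A \<equiv> \<lambda>w. \<theta>1 w + \<theta>2 (\<sigma>i w)"
  defines "W \<equiv> \<lambda>t. max (V1 (fst (x t))) (\<sigma> (V2 (snd (x t))))"
  shows "A (W t) \<le> max (A (W 0) - t) (A (max k1 (\<sigma> k2)))"
proof -
  define v1 where "v1 s = V1 (fst (x s))" for s
  define v2 where "v2 s = V2 (snd (x s))" for s
  have v0: "0 \<le> v1 s" "0 \<le> v2 s" for s using V1 V2 by (auto simp: v1_def v2_def)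
  have W: "W s = max (v1 s) (\<sigma> (v2 s))" for s by (simp add: W_def v1_def v2_def)
  have K\<theta>: "class_K \<theta>1" "class_K \<theta>2" using settling by (auto simp: settling_function_def)
  have KA: "class_K A" unfolding A_def by (intro class_K_add class_K_comp[OF K\<theta>(2)] K\<theta> \<sigma>)
  have A\<sigma>: "A (\<sigma> v) = \<theta>1 (\<sigma> v) + \<theta>2 v" if "0 \<le> v" for v using that by (simp add: A_def \<sigma>(3))
  have \<sigma>0: "0 \<le> \<sigma> (v2 s)" for s using class_K_D(4)[OF \<sigma>(1)] v0 by blast
  have W0: "0 \<le> W s" for s using v0 by (simp add: W le_max_iff_disj)
  have traj1: "trajectory 0 S (\<lambda>s. fst (F s)) (\<lambda>s. fst (x s))"
    by (rule trajectory_linear_image[OF traj bounded_linear_fst])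
  have traj2: "trajectory 0 S (\<lambda>s. snd (F s)) (\<lambda>s. snd (x s))"
    by (rule trajectory_linear_image[OF traj bounded_linear_snd])
  have cv1: "continuous_on {0..S} v1" unfolding v1_def
    by (rule continuous_on_compose2[OF locally_lipschitz_imp_continuous_on[OF V1(1)] trajectory_continuous_on[OF traj1], of UNIV]) auto
  have cv2: "continuous_on {0..S} v2" unfolding v2_def
    by (rule continuous_on_compose2[OF locally_lipschitz_imp_continuous_on[OF V2(1)] trajectory_continuous_on[OF traj2], of UNIV]) auto
  have c\<sigma>: "continuous_on {0..S} (\<lambda>s. \<sigma> (v2 s))"
    by (rule continuous_on_compose2[OF class_K_D(1)[OF \<sigma>(1)] cv2]) (use v0 in auto)
  have cW: "continuous_on {0..S} W" unfolding W by (intro continuous_intros cv1 c\<sigma>)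
  have cA: "continuous_on {0..S} (\<lambda>s. A (W s))"
    by (rule continuous_on_compose2[OF class_K_D(1)[OF KA] cW]) (use W0 in auto)
  have dec1: "\<exists>h>0. \<forall>s\<in>{t..t+h}. s \<le> S \<longrightarrow> A (v1 s) \<le> A (v1 t) - (s - t)"
    if "0 \<le> t" "t < S" "gam1 (v2 t) < v1 t" "k1 < v1 t" for t
  proof -
    have cq: "continuous_on {0..S} (\<lambda>s. max (gam1 (v2 s)) k1)"
      by (intro continuous_intros continuous_on_compose2[OF class_K_D(1)[OF gam(1)] cv2]) (use v0 in auto)
    have "\<exists>h>0. \<forall>s\<in>{t..t+h}. s \<le> S \<longrightarrow> \<theta>1 (V1 (fst (x s))) \<le> \<theta>1 (V1 (fst (x t))) - (s - t)"
      by (rule gain_decrease[OF traj1 V1(1) cq _ _ settling(1)])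
         (use that k decr1 in \<open>auto simp: v1_def v2_def\<close>)
    then obtain h where h: "h > 0" "\<And>s. s \<in> {t..t+h} \<Longrightarrow> s \<le> S \<Longrightarrow> \<theta>1 (v1 s) \<le> \<theta>1 (v1 t) - (s - t)"
      by (auto simp: v1_def)
    have "A (v1 s) \<le> A (v1 t) - (s - t)" if s: "s \<in> {t..t+h}" "s \<le> S" for s
    proof -
      have "\<theta>1 (v1 s) \<le> \<theta>1 (v1 t)" using h(2)[OF s] s by simp
      then have "v1 s \<le> v1 t" using class_K_le_iff[OF K\<theta>(1)] v0 by simp
      then have "\<theta>2 (\<sigma>i (v1 s)) \<le> \<theta>2 (\<sigma>i (v1 t))"
        using class_K_D(5)[OF class_K_comp[OF K\<theta>(2) \<sigma>(2)]] v0 by blast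
      then show ?thesis using h(2)[OF s] by (simp add: A_def)
    qed
    then show ?thesis using h(1) by blast
  qed
  have dec2: "\<exists>h>0. \<forall>s\<in>{t..t+h}. s \<le> S \<longrightarrow> A (\<sigma> (v2 s)) \<le> A (\<sigma> (v2 t)) - (s - t)"
    if "0 \<le> t" "t < S" "gam2 (v1 t) < v2 t" "k2 < v2 t" for t
  proof -
    have cq: "continuous_on {0..S} (\<lambda>s. max (gam2 (v1 s)) k2)"
      by (intro continuous_intros continuous_on_compose2[OF class_K_D(1)[OF gam(2)] cv1]) (use v0 in auto)
    have "\<exists>h>0. \<forall>s\<in>{t..t+h}. s \<le> S \<longrightarrow> \<theta>2 (V2 (snd (x s))) \<le> \<theta>2 (V2 (snd (x t))) - (s - t)"
      by (rule gain_decrease[OF traj2 V2(1) cq _ _ settling(2)])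
         (use that k decr2 in \<open>auto simp: v1_def v2_def\<close>)
    then obtain h where h: "h > 0" "\<And>s. s \<in> {t..t+h} \<Longrightarrow> s \<le> S \<Longrightarrow> \<theta>2 (v2 s) \<le> \<theta>2 (v2 t) - (s - t)"
      by (auto simp: v2_def)
    have "A (\<sigma> (v2 s)) \<le> A (\<sigma> (v2 t)) - (s - t)" if s: "s \<in> {t..t+h}" "s \<le> S" for s
    proof -
      have "\<theta>2 (v2 s) \<le> \<theta>2 (v2 t)" using h(2)[OF s] s by simp
      then have "v2 s \<le> v2 t" using class_K_le_iff[OF K\<theta>(2)] v0 by simp
      then have "\<theta>1 (\<sigma> (v2 s)) \<le> \<theta>1 (\<sigma> (v2 t))"
        using class_K_D(5)[OF class_K_comp[OF K\<theta>(1) \<sigma>(1)]] v0 by blast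
      then show ?thesis using h(2)[OF s] by (simp add: A\<sigma> v0)
    qed
    then show ?thesis using h(1) by blast
  qed
  show ?thesis
  proof (rule level_decrease[OF cA t])
    fix t assume t: "0 \<le> t" "t < S" "A (max k1 (\<sigma> k2)) < A (W t)"
    have "0 \<le> max k1 (\<sigma> k2)" using k by simp
    then have Wk: "max k1 (\<sigma> k2) < W t" using t(3) class_K_less_iff[OF KA] W0 by blast
    have w2: "k2 < v2 t" if "W t = \<sigma> (v2 t)"
      using Wk class_K_less_iff[OF \<sigma>(1) k(2) v0(2)] by (simp add: that)
    \<comment> \<open>Stated with \<open>\<le>\<close> so that it serves both strict dominance of
      \<open>\<sigma> (v2 t)\<close> and the tie.\<close>
    have g2: "gam2 (v1 t) < v2 t" if "v1 t \<le> \<sigma> (v2 t)"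
    proof -
      have "W t = \<sigma> (v2 t)" using that by (simp add: W)
      then have "0 < v2 t" using w2 k by simp
      moreover have "gam2 (v1 t) \<le> gam2 (\<sigma> (v2 t))" using class_K_D(5)[OF gam(2) v0(1) that] .
      ultimately show ?thesis using gap(2)[of "v2 t"] by simp
    qed
    consider "\<sigma> (v2 t) < v1 t" | "v1 t < \<sigma> (v2 t)" | "v1 t = \<sigma> (v2 t)" by linarith
    then show "\<exists>h>0. \<forall>s\<in>{t..t+h}. s \<le> S \<longrightarrow> A (W s) \<le> A (W t) - (s - t)"
    proof cases
      case 1
      \<comment> \<open>\<open>v2 t\<close> may be 0 here, where \<open>gap\<close> is silent; the
        non-strict bound is enough because the case assumption is strict.\<close>
      have "gam1 (v2 t) \<le> \<sigma> (v2 t)"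
        using gap(1)[of "v2 t"] v0(2)[of t] class_K_D(3)[OF gam(1)] class_K_D(3)[OF \<sigma>(1)]
        by (cases "v2 t = 0") auto
      then have "\<exists>h>0. \<forall>s\<in>{t..t+h}. s \<le> S \<longrightarrow> A (v1 s) \<le> A (v1 t) - (s - t)"
        using 1 Wk by (intro dec1 t) (auto simp: W)
      then obtain h where h: "h > 0" "\<forall>s\<in>{t..t+h}. s \<le> S \<longrightarrow> A (v1 s) \<le> A (v1 t) - (s - t)" by blast
      obtain h' where h': "h' > 0" "\<forall>s\<in>{t..t+h'}. s \<le> S \<longrightarrow> \<sigma> (v2 s) < v1 s"
        using continuous_less_persists[OF cv1 c\<sigma> t(1,2) 1] by blast
      have "A (W s) \<le> A (W t) - (s - t)" if s: "s \<in> {t..t + min h h'}" "s \<le> S" for s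
      proof -
        have "\<sigma> (v2 s) < v1 s" "A (v1 s) \<le> A (v1 t) - (s - t)" using h(2) h'(2) s by auto
        then show ?thesis using 1 by (simp add: W max_def)
      qed
      then show ?thesis using h(1) h'(1) by (intro exI[of _ "min h h'"]) auto
    next
      case 2
      then have "\<exists>h>0. \<forall>s\<in>{t..t+h}. s \<le> S \<longrightarrow> A (\<sigma> (v2 s)) \<le> A (\<sigma> (v2 t)) - (s - t)"
        by (intro dec2 t g2 w2) (auto simp: W)
      then obtain h where h: "h > 0" "\<forall>s\<in>{t..t+h}. s \<le> S \<longrightarrow> A (\<sigma> (v2 s)) \<le> A (\<sigma> (v2 t)) - (s - t)" by blast
      obtain h' where h': "h' > 0" "\<forall>s\<in>{t..t+h'}. s \<le> S \<longrightarrow> v1 s < \<sigma> (v2 s)"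
        using continuous_less_persists[OF c\<sigma> cv1 t(1,2) 2] by blast
      have "A (W s) \<le> A (W t) - (s - t)" if s: "s \<in> {t..t + min h h'}" "s \<le> S" for s
      proof -
        have "v1 s < \<sigma> (v2 s)" "A (\<sigma> (v2 s)) \<le> A (\<sigma> (v2 t)) - (s - t)" using h(2) h'(2) s by auto
        then show ?thesis using 2 by (simp add: W max_def)
      qed
      then show ?thesis using h(1) h'(1) by (intro exI[of _ "min h h'"]) auto
    next
      case 3
      have Wt: "W t = \<sigma> (v2 t)" using 3 by (simp add: W)
      have "\<exists>h>0. \<forall>s\<in>{t..t+h}. s \<le> S \<longrightarrow> A (\<sigma> (v2 s)) \<le> A (\<sigma> (v2 t)) - (s - t)"
        using 3 Wt by (intro dec2 t g2 w2) auto
      then obtain h where h: "h > 0" "\<forall>s\<in>{t..t+h}. s \<le> S \<longrightarrow> A (\<sigma> (v2 s)) \<le> A (\<sigma> (v2 t)) - (s - t)" by blast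
      \<comment> \<open>At a tie the gain inequality itself must be strict. It is, because being
        above the level makes \<open>v2 t > k2 \<ge> 0\<close>.\<close>
      have "gam1 (v2 t) < v1 t" using gap(1)[of "v2 t"] w2[OF Wt] k 3 by simp
      then have "\<exists>h>0. \<forall>s\<in>{t..t+h}. s \<le> S \<longrightarrow> A (v1 s) \<le> A (v1 t) - (s - t)"
        using 3 Wk Wt by (intro dec1 t) auto
      then obtain h' where h': "h' > 0" "\<forall>s\<in>{t..t+h'}. s \<le> S \<longrightarrow> A (v1 s) \<le> A (v1 t) - (s - t)" by blast
      \<comment> \<open>Right after a tie \<open>W\<close> may follow either function and may switch
        between them; both are below the same line, so their maximum is.\<close>
      have "A (W s) \<le> A (W t) - (s - t)" if s: "s \<in> {t..t + min h h'}" "s \<le> S" for s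
      proof -
        have "A (v1 s) \<le> A (W t) - (s - t)" "A (\<sigma> (v2 s)) \<le> A (W t) - (s - t)"
          using h(2) h'(2) s 3 Wt by auto
        then show ?thesis unfolding W max_def by presburger
      qed
      then show ?thesis using h(1) h'(1) by (intro exI[of _ "min h h'"]) auto
    qed
  qed
qed

section \<open>The fixed-time comparison function and the conclusion\<close>

lemma class_K_cong:
  assumes "class_K g" "\<And>s. 0 \<le> s \<Longrightarrow> f s = g s"
  shows "class_K f"
proof (rule class_KI)
  show "continuous_on {0..} f"
    by (rule continuous_on_eq[OF class_K_D(1)[OF assms(1)]]) (simp add: assms(2))
qed (use class_K_D[OF assms(1)] assms(2) in auto)

text \<open>The formula arises by solving \<open>A w \<le> A (m r) - t\<close> for \<open>w\<close>
  and converting the level by \<open>\<kappa>\<close>. Truncation at 0 keeps the argument in the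
  range of \<open>A\<close>, where \<open>J\<close> is its continuous inverse. The value is 0 from
  time \<open>A (m r)\<close> on, and this settling time is bounded because \<open>A\<close>
  is.\<close>

lemma class_KL_FxT_from_settling:
  assumes A: "class_K A" "bdd_above (A ` {0..})"
    and J: "continuous_on (A ` {0..}) J" "\<And>s. 0 \<le> s \<Longrightarrow> J (A s) = s"
    and \<kappa>: "class_K \<kappa>" and m: "class_K m"
  shows "class_KL_FxT (\<lambda>r t. \<kappa> (J (max (A (m r) - t) 0)))"
proof -
  let ?\<beta> = "\<lambda>r t. \<kappa> (J (max (A (m r) - t) 0))"
  have KE: "class_K (\<lambda>r. A (m r))" by (rule class_K_comp[OF A(1) m])
  have in_A: "max (A (m r) - t) 0 \<in> A ` {0..}" if "0 \<le> r" "0 \<le> t" for r t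
  proof (rule class_K_image_downward[OF A(1)])
    show "0 \<le> m r" using class_K_D(4)[OF m] that by blast
    show "max (A (m r) - t) 0 \<le> A (m r)" using class_K_D(4)[OF KE] that by simp
  qed simp
  have J0: "0 \<le> J y" if "y \<in> A ` {0..}" for y using that J(2) by auto
  have Jmono: "J y \<le> J z" if "y \<in> A ` {0..}" "z \<in> A ` {0..}" "y \<le> z" for y z
    using that J(2) class_K_le_iff[OF A(1)] by auto
  have JA0: "J 0 = 0" using J(2)[of 0] class_K_D(3)[OF A(1)] by simp
  have cont: "continuous_on ({0..} \<times> {0..}) (\<lambda>(r, t). ?\<beta> r t)"
  proof -
    have cE: "continuous_on ({0..} \<times> {0..}) (\<lambda>z. A (m (fst z)))"
      by (rule continuous_on_compose2[OF class_K_D(1)[OF KE]]) (auto intro: continuous_intros)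
    have "continuous_on ({0..} \<times> {0..}) (\<lambda>z. max (A (m (fst z)) - snd z) 0)"
      by (intro continuous_intros cE)
    then have "continuous_on ({0..} \<times> {0..}) (\<lambda>z. J (max (A (m (fst z)) - snd z) 0))"
      by (rule continuous_on_compose2[OF J(1)]) (use in_A in auto)
    then have "continuous_on ({0..} \<times> {0..}) (\<lambda>z. ?\<beta> (fst z) (snd z))"
      by (rule continuous_on_compose2[OF class_K_D(1)[OF \<kappa>]]) (use in_A J0 in auto)
    then show ?thesis by (simp add: case_prod_unfold)
  qed
  show ?thesis
    unfolding class_KL_FxT_def
  proof (intro conjI allI impI)
    show "continuous_on ({0..} \<times> {0..}) (\<lambda>(r, t). ?\<beta> r t)" by (rule cont)
    show "0 \<le> ?\<beta> r t" if "0 \<le> r" "0 \<le> t" for r t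
      by (rule class_K_D(4)[OF \<kappa> J0[OF in_A[OF that]]])
    show "class_K (\<lambda>r. ?\<beta> r 0)"
    proof (rule class_K_cong[OF class_K_comp[OF \<kappa> m]])
      fix r :: real assume "0 \<le> r"
      then show "?\<beta> r 0 = \<kappa> (m r)" using class_K_D(4)[OF KE, of r] class_K_D(4)[OF m, of r] J(2) by simp
    qed
    fix r :: real assume r: "0 \<le> r"
    show "continuous_on {0..} (?\<beta> r)"
    proof -
      have "continuous_on {0..} (\<lambda>t. case (r, t) of (r, t) \<Rightarrow> ?\<beta> r t)"
        by (rule continuous_on_compose2[OF cont]) (use r in \<open>auto intro: continuous_intros\<close>)
      then show ?thesis by simp
    qed
    show "antimono_on {0..} (?\<beta> r)"
    proof (rule monotone_onI)
      fix s t :: real assume st: "s \<in> {0..}" "t \<in> {0..}" "s \<le> t"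
      have "J (max (A (m r) - t) 0) \<le> J (max (A (m r) - s) 0)"
        by (rule Jmono) (use in_A r st in auto)
      then show "?\<beta> r t \<le> ?\<beta> r s"
        using class_K_D(5)[OF \<kappa>] J0 in_A r st by simp
    qed
  next
    show "\<exists>T. continuous_on {0..} T \<and> bounded (T ` {0..}) \<and> (\<forall>r\<ge>0. 0 \<le> T r) \<and> T 0 = 0 \<and>
      (\<forall>r\<ge>0. \<forall>t\<ge>T r. ?\<beta> r t = 0)"
    proof (intro exI[of _ "\<lambda>r. A (m r)"] conjI allI impI)
      show "continuous_on {0..} (\<lambda>r. A (m r))" "A (m 0) = 0"
        using class_K_D(1,3)[OF KE] by auto
      obtain B where B: "\<And>w. 0 \<le> w \<Longrightarrow> A w \<le> B" using A(2) by (auto simp: bdd_above_def)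
      have "norm (A (m r)) \<le> B" if "0 \<le> r" for r
        using class_K_D(4)[OF KE that] B class_K_D(4)[OF m that] by simp
      then show "bounded ((\<lambda>r. A (m r)) ` {0..})" unfolding bounded_iff by auto
      show "0 \<le> A (m r)" if "0 \<le> r" for r using class_K_D(4)[OF KE that] .
      show "?\<beta> r t = 0" if "0 \<le> r" "A (m r) \<le> t" for r t
        using that JA0 class_K_D(3)[OF \<kappa>] by (simp add: max_def)
    qed
  qed
qed

theorem theorem1:
  fixes f1 :: "real^'n1 \<Rightarrow> real^'n2 \<Rightarrow> real^'m1 \<Rightarrow> real^'n1"
    and f2 :: "real^'n1 \<Rightarrow> real^'n2 \<Rightarrow> real^'m2 \<Rightarrow> real^'n2"
    and V1 :: "real^'n1 \<Rightarrow> real" and V2 :: "real^'n2 \<Rightarrow> real"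
    and alo1 ahi1 chi1 gam1 Psi1 ghat1 :: "real \<Rightarrow> real"
    and alo2 ahi2 chi2 gam2 Psi2 ghat2 :: "real \<Rightarrow> real"
  assumes f1_cont: "continuous_on UNIV (\<lambda>(a, b, c). f1 a b c)"
    and f2_cont: "continuous_on UNIV (\<lambda>(a, b, c). f2 a b c)"
    and f1_0: "f1 0 0 0 = 0" and f2_0: "f2 0 0 0 = 0"
    and V1_lip: "locally_lipschitz V1" and V2_lip: "locally_lipschitz V2"
    and V1_nonneg: "\<forall>x. V1 x \<ge> 0" and V2_nonneg: "\<forall>x. V2 x \<ge> 0"
    and alpha1: "class_Kinf alo1" "class_Kinf ahi1"
    and alpha2: "class_Kinf alo2" "class_Kinf ahi2"
    and sandwich1: "\<forall>x. alo1 (norm x) \<le> V1 x \<and> V1 x \<le> ahi1 (norm x)"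
    and sandwich2: "\<forall>x. alo2 (norm x) \<le> V2 x \<and> V2 x \<le> ahi2 (norm x)"
    and gains1: "class_Kinf chi1" "class_Kinf gam1" "class_KFxT Psi1"
    and gains2: "class_Kinf chi2" "class_Kinf gam2" "class_KFxT Psi2"
    and decr1: "\<forall>x1 x2 u1. V1 x1 \<ge> max (gam1 (V2 x2)) (chi1 (norm u1)) \<longrightarrow>
                  dini_deriv V1 x1 (f1 x1 x2 u1) \<le> ereal (- Psi1 (V1 x1))"
    and decr2: "\<forall>x1 x2 u2. V2 x2 \<ge> max (gam2 (V1 x1)) (chi2 (norm u2)) \<longrightarrow>
                  dini_deriv V2 x2 (f2 x1 x2 u2) \<le> ereal (- Psi2 (V2 x2))"
    and ghat1: "class_KP ghat1 \<or> class_KPinv ghat1" "\<forall>s>0. ghat1 s > gam1 s"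
    and ghat2: "class_KP ghat2 \<or> class_KPinv ghat2" "\<forall>s>0. ghat2 s > gam2 s"
    and small_gain: "\<forall>s>0. ghat1 (ghat2 s) < s"
  shows "FxT_ISS (\<lambda>(x1::real^'n1, x2::real^'n2) (u1::real^'m1, u2::real^'m2).
                    (f1 x1 x2 u1, f2 x1 x2 u2))"
proof -
  let ?f = "\<lambda>(x1::real^'n1, x2::real^'n2) (u1::real^'m1, u2::real^'m2). (f1 x1 x2 u1, f2 x1 x2 u2)"
  have \<sigma>inf: "class_Kinf ghat1" using ghat1(1) by (auto simp: class_KP_def class_KPinv_def)
  have \<sigma>: "class_K ghat1" using \<sigma>inf by (simp add: class_Kinf_def)
  have K: "class_K gam1" "class_K gam2" "class_K chi1" "class_K chi2" "class_K ahi1" "class_K ahi2"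
    "class_K alo1" "class_K alo2"
    using gains1 gains2 alpha1 alpha2 by (auto simp: class_Kinf_def)
  obtain \<sigma>i where \<sigma>i: "class_K \<sigma>i" "\<And>s. 0 \<le> s \<Longrightarrow> \<sigma>i (ghat1 s) = s"
    by (rule class_Kinf_inverse[OF \<sigma>inf]) (rule that)
  obtain a1 where a1: "class_K a1" "\<And>s. 0 \<le> s \<Longrightarrow> a1 (alo1 s) = s"
    by (rule class_Kinf_inverse[OF alpha1(1)]) (rule that)
  obtain a2 where a2: "class_K a2" "\<And>s. 0 \<le> s \<Longrightarrow> a2 (alo2 s) = s"
    by (rule class_Kinf_inverse[OF alpha2(1)]) (rule that)
  obtain \<theta>1 where \<theta>1: "settling_function Psi1 \<theta>1" by (rule class_KFxT_settling_function[OF gains1(3)]) (rule that)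
  obtain \<theta>2 where \<theta>2: "settling_function Psi2 \<theta>2" by (rule class_KFxT_settling_function[OF gains2(3)]) (rule that)
  have gap1: "gam1 s < ghat1 s" if "0 < s" for s using ghat1(2) that by blast
  \<comment> \<open>The small-gain condition bounds \<open>ghat1\<close> after \<open>ghat2\<close>,
    whereas the other order is wanted: apply it at \<open>ghat1 s\<close> and cancel the outer
    \<open>ghat1\<close>.\<close>
  have gap2: "gam2 (ghat1 s) < s" if s: "0 < s" for s
  proof -
    have pos: "0 < ghat1 s" using class_K_D(6)[OF \<sigma>, of 0 s] class_K_D(3)[OF \<sigma>] s by simp
    have "ghat1 (ghat2 (ghat1 s)) < ghat1 s" using small_gain pos by blast
    moreover have "0 \<le> ghat2 (ghat1 s)"
      using ghat2(2) pos class_K_D(4)[OF K(2), of "ghat1 s"] by force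
    ultimately have "ghat2 (ghat1 s) < s" using class_K_less_iff[OF \<sigma>] s by simp
    then show ?thesis using ghat2(2) pos by force
  qed
  define A where "A w = \<theta>1 w + \<theta>2 (\<sigma>i w)" for w
  \<comment> \<open>\<open>m\<close> bounds \<open>W\<close> at time 0 through the upper sandwich
    bounds, and \<open>k\<close> is the level of the small-gain estimate for inputs bounded by
    \<open>c\<close>. \<open>\<kappa>\<close> returns from \<open>W\<close> to the norm:
    \<open>norm (fst x) \<le> a1 W\<close> and \<open>norm (snd x) \<le> a2 (\<sigma>i W)\<close> by
    the lower sandwich bounds.\<close>
  define m where "m r = max (ahi1 r) (ghat1 (ahi2 r))" for r
  define k where "k c = max (chi1 c) (ghat1 (chi2 c))" for c
  define \<kappa> where "\<kappa> w = a1 w + a2 (\<sigma>i w)" for w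
  have Km: "class_K m" unfolding m_def by (intro class_K_max K class_K_comp[OF \<sigma>])
  have Kk: "class_K k" unfolding k_def by (intro class_K_max K class_K_comp[OF \<sigma>])
  have K\<kappa>: "class_K \<kappa>" unfolding \<kappa>_def by (intro class_K_add a1 class_K_comp[OF a2(1)] \<sigma>i)
  have K\<theta>: "class_K \<theta>1" "class_K \<theta>2" using \<theta>1 \<theta>2 by (auto simp: settling_function_def)
  have KA: "class_K A" unfolding A_def by (intro class_K_add K\<theta> class_K_comp[OF K\<theta>(2)] \<sigma>i)
  have bddA: "bdd_above (A ` {0..})"
  proof -
    obtain B1 B2 where "\<And>v. 0 \<le> v \<Longrightarrow> \<theta>1 v \<le> B1" "\<And>v. 0 \<le> v \<Longrightarrow> \<theta>2 v \<le> B2"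
      using \<theta>1 \<theta>2 by (auto simp: settling_function_def bdd_above_def)
    then have "A w \<le> B1 + B2" if "0 \<le> w" for w
      using that class_K_D(4)[OF \<sigma>i(1)] by (simp add: A_def add_mono)
    then show ?thesis by (auto intro!: bdd_aboveI)
  qed
  obtain J where J: "continuous_on (A ` {0..}) J" "\<And>s. 0 \<le> s \<Longrightarrow> J (A s) = s"
    by (rule class_K_inverse[OF KA]) (rule that)
  define \<beta> where "\<beta> r t = \<kappa> (J (max (A (m r) - t) 0))" for r t
  define \<rho> where "\<rho> c = \<kappa> (k c)" for c
  have K\<beta>: "class_KL_FxT \<beta>"
    unfolding \<beta>_def by (rule class_KL_FxT_from_settling[OF KA bddA J K\<kappa> Km])
  have K\<rho>: "class_K \<rho>" unfolding \<rho>_def by (rule class_K_comp[OF K\<kappa> Kk])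
  have contf: "continuous_on UNIV (\<lambda>(x, v). ?f x v)"
  proof -
    have "continuous_on UNIV (\<lambda>z::((real^'n1) \<times> (real^'n2)) \<times> (real^'m1) \<times> (real^'m2). case (fst (fst z), snd (fst z), fst (snd z)) of (a, b, c) \<Rightarrow> f1 a b c)"
      by (rule continuous_on_compose2[OF f1_cont]) (auto intro!: continuous_intros)
    moreover have "continuous_on UNIV (\<lambda>z::((real^'n1) \<times> (real^'n2)) \<times> (real^'m1) \<times> (real^'m2). case (fst (fst z), snd (fst z), snd (snd z)) of (a, b, c) \<Rightarrow> f2 a b c)"
      by (rule continuous_on_compose2[OF f2_cont]) (auto intro!: continuous_intros)
    ultimately have "continuous_on UNIV (\<lambda>z::((real^'n1) \<times> (real^'n2)) \<times> (real^'m1) \<times> (real^'m2).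
        (f1 (fst (fst z)) (snd (fst z)) (fst (snd z)), f2 (fst (fst z)) (snd (fst z)) (snd (snd z))))"
      by (simp add: continuous_on_Pair)
    then show ?thesis by (simp add: case_prod_unfold)
  qed
  \<comment> \<open>On a compact interval and for every solution, so that it serves twice: as the
    stability estimate and as the a priori bound for continuation.\<close>
  have estimate: "norm (x t) \<le> \<beta> (norm x0) t + \<rho> c"
    if c: "0 \<le> c" and u: "\<And>s. norm (u s) \<le> c" and x: "is_solution ?f u x0 {0..S} x" and t: "t \<in> {0..S}"
    for u x0 S x t c
  proof -
    have S: "0 \<le> S" using t by simp
    define F where "F s = ?f (x s) (u s)" for s
    have F: "fst (F s) = f1 (fst (x s)) (snd (x s)) (fst (u s))" "snd (F s) = f2 (fst (x s)) (snd (x s)) (snd (u s))" for s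
      by (simp_all add: F_def case_prod_unfold)
    have traj: "trajectory 0 S F x"
      unfolding F_def by (rule is_solution_trajectory[OF contf u S x])
    define W where "W s = max (V1 (fst (x s))) (ghat1 (V2 (snd (x s))))" for s
    \<comment> \<open>Raising the thresholds to the constants \<open>chi1 c\<close> and
      \<open>chi2 c\<close> strengthens the premises of the decrease conditions, which therefore
      remain valid.\<close>
    have u12: "chi1 (norm (fst (u s))) \<le> chi1 c" "chi2 (norm (snd (u s))) \<le> chi2 c" for s
      using u[of s] norm_fst_le[of "fst (u s)" "snd (u s)"] norm_snd_le[of "snd (u s)" "fst (u s)"]
      by (auto intro!: class_K_D(5)[OF K(3)] class_K_D(5)[OF K(4)])
    have est: "A (W t) \<le> max (A (W 0) - t) (A (k c))"
      unfolding A_def W_def k_def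
    proof (rule small_gain_estimate[OF traj V1_lip _ V2_lip _ K(1,2) \<theta>1 \<theta>2])
      fix s assume "max (gam1 (V2 (snd (x s)))) (chi1 c) \<le> V1 (fst (x s))"
      then have "max (gam1 (V2 (snd (x s)))) (chi1 (norm (fst (u s)))) \<le> V1 (fst (x s))"
        using u12(1)[of s] by simp
      then show "dini_deriv V1 (fst (x s)) (fst (F s)) \<le> ereal (- Psi1 (V1 (fst (x s))))"
        unfolding F using decr1 by blast
    next
      fix s assume "max (gam2 (V1 (fst (x s)))) (chi2 c) \<le> V2 (snd (x s))"
      then have "max (gam2 (V1 (fst (x s)))) (chi2 (norm (snd (u s)))) \<le> V2 (snd (x s))"
        using u12(2)[of s] by simp
      then show "dini_deriv V2 (snd (x s)) (snd (F s)) \<le> ereal (- Psi2 (V2 (snd (x s))))"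
        unfolding F using decr2 by blast
    qed (use V1_nonneg V2_nonneg class_K_D(4)[OF K(3) c] class_K_D(4)[OF K(4) c] \<sigma> \<sigma>i gap1 gap2 t in auto)
    have W0: "0 \<le> W s" for s using V1_nonneg by (simp add: W_def le_max_iff_disj)
    have m0: "0 \<le> m (norm x0)" using class_K_D(4)[OF Km] by simp
    have k0: "0 \<le> k c" using class_K_D(4)[OF Kk c] .
    have "W 0 \<le> m (norm x0)"
    proof -
      have x0: "x 0 = x0" by (rule is_solutionD(1)[OF x])
      have n: "norm (fst x0) \<le> norm x0" "norm (snd x0) \<le> norm x0"
        using norm_fst_le[of "fst x0" "snd x0"] norm_snd_le[of "snd x0" "fst x0"] by auto
      have "V1 (fst x0) \<le> ahi1 (norm x0)"
        using sandwich1 class_K_D(5)[OF K(5) norm_ge_zero n(1)] order_trans by blast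
      moreover have "V2 (snd x0) \<le> ahi2 (norm x0)"
        using sandwich2 class_K_D(5)[OF K(6) norm_ge_zero n(2)] order_trans by blast
      then have "ghat1 (V2 (snd x0)) \<le> ghat1 (ahi2 (norm x0))"
        using class_K_D(5)[OF \<sigma>] V2_nonneg by blast
      ultimately show ?thesis by (auto simp: W_def m_def x0)
    qed
    then have "A (W 0) \<le> A (m (norm x0))" using class_K_D(5)[OF KA W0] by blast
    define y where "y = max (A (m (norm x0)) - t) 0"
    have "y \<in> A ` {0..}"
    proof (rule class_K_image_downward[OF KA m0])
      show "y \<le> A (m (norm x0))" using class_K_D(4)[OF KA m0] t by (simp add: y_def)
    qed (simp add: y_def)
    then obtain w where w: "0 \<le> w" "y = A w" by auto
    have "A (W t) \<le> max (A w) (A (k c))"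
      using est \<open>A (W 0) \<le> A (m (norm x0))\<close> unfolding w(2)[symmetric] y_def by linarith
    \<comment> \<open>Strict monotonicity of \<open>A\<close> turns the maximum into two
      alternatives. Under \<open>\<kappa>\<close> each of them lies below the sum
      \<open>\<beta> + \<rho>\<close>, both terms being nonnegative.\<close>
    then have "W t \<le> w \<or> W t \<le> k c"
      using class_K_le_iff[OF KA W0] w(1) k0 by (auto simp: le_max_iff_disj)
    then have "\<kappa> (W t) \<le> \<kappa> w \<or> \<kappa> (W t) \<le> \<kappa> (k c)"
      using class_K_D(5)[OF K\<kappa> W0] by blast
    moreover have "\<kappa> w = \<beta> (norm x0) t"
      unfolding \<beta>_def y_def[symmetric] by (simp add: w J(2))
    ultimately have kW: "\<kappa> (W t) \<le> \<beta> (norm x0) t + \<rho> c"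
      using class_K_D(4)[OF K\<kappa> w(1)] class_K_D(4)[OF K\<kappa> k0] by (auto simp: \<rho>_def)
    have "norm (fst (x t)) \<le> a1 (W t)"
    proof -
      have "norm (fst (x t)) = a1 (alo1 (norm (fst (x t))))" by (simp add: a1)
      also have "\<dots> \<le> a1 (W t)"
        using sandwich1 class_K_D(4)[OF K(7)] by (intro class_K_D(5)[OF a1(1)]) (auto simp: W_def le_max_iff_disj)
      finally show ?thesis .
    qed
    moreover have "norm (snd (x t)) \<le> a2 (\<sigma>i (W t))"
    proof -
      have "norm (snd (x t)) = a2 (alo2 (norm (snd (x t))))" by (simp add: a2)
      also have "\<dots> \<le> a2 (V2 (snd (x t)))"
        using sandwich2 class_K_D(4)[OF K(8)] by (intro class_K_D(5)[OF a2(1)]) auto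
      also have "V2 (snd (x t)) = \<sigma>i (ghat1 (V2 (snd (x t))))" using V2_nonneg by (simp add: \<sigma>i)
      also have "a2 \<dots> \<le> a2 (\<sigma>i (W t))"
      proof (rule class_K_D(5)[OF class_K_comp[OF a2(1) \<sigma>i(1)]])
        show "0 \<le> ghat1 (V2 (snd (x t)))" using class_K_D(4)[OF \<sigma>] V2_nonneg by blast
      qed (simp add: W_def)
      finally show ?thesis .
    qed
    moreover have "norm (x t) \<le> norm (fst (x t)) + norm (snd (x t))"
      using norm_Pair_le[of "fst (x t)" "snd (x t)"] by simp
    ultimately show ?thesis using kW unfolding \<kappa>_def by linarith
  qed
  show ?thesis
    unfolding FxT_ISS_def
  proof (intro exI[of _ \<beta>] exI[of _ \<rho>] conjI allI impI K\<beta> K\<rho>)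
    fix x0 :: "(real^'n1) \<times> (real^'n2)" and u :: "real \<Rightarrow> (real^'m1) \<times> (real^'m2)"
    assume adm: "admissible_input u"
    obtain u' N where u': "u' \<in> borel_measurable lebesgue" "\<And>t. norm (u' t) \<le> linf_norm u"
      and N: "negligible N" "\<And>t. 0 \<le> t \<Longrightarrow> t \<notin> N \<Longrightarrow> u' t = u t"
      using bounded_representative_of_admissible_input[OF adm] by blast
    have sol: "is_solution ?f u x0 I x \<longleftrightarrow> is_solution ?f u' x0 I x" for I x
      by (rule is_solution_AE_cong[OF N(1)]) (rule N(2))
    note c = linf_norm_nonneg[OF adm]
    {
      fix x t assume "is_solution ?f u x0 {0..} x" and t: "(0::real) \<le> t"
      then have "is_solution ?f u' x0 {0..} x" by (simp only: sol)
      then have "is_solution ?f u' x0 {0..t} x" by (rule is_solution_subset) auto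
      then show "norm (x t) \<le> \<beta> (norm x0) t + \<rho> (linf_norm u)"
        by (rule estimate[OF c u'(2)]) (use t in auto)
    next
      fix T x assume Tx: "0 < T \<and> is_solution ?f u x0 {0..<T} x"
      have "\<exists>y. is_solution ?f u' x0 {0..} y \<and> (\<forall>t\<in>{0..<T}. y t = x t)"
      proof (rule is_solution_global[OF contf u'])
        fix S y t assume y: "is_solution ?f u' x0 {0..S} y" and t: "t \<in> {0..S}"
        \<comment> \<open>Continuation needs one bound for all \<open>S\<close> and
          \<open>t\<close>; monotonicity in time allows \<open>\<beta>\<close> to be taken at time
          0.\<close>
        have "norm (y t) \<le> \<beta> (norm x0) t + \<rho> (linf_norm u)" by (rule estimate[OF c u'(2) y t])
        also have "\<beta> (norm x0) t \<le> \<beta> (norm x0) 0"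
        proof -
          have "antimono_on {0..} (\<beta> (norm x0))"
            using K\<beta>[unfolded class_KL_FxT_def, THEN conjunct2, THEN conjunct2, THEN conjunct2, THEN conjunct1]
            by (meson norm_ge_zero)
          then show ?thesis by (rule monotone_onD) (use t in auto)
        qed
        finally show "norm (y t) \<le> \<beta> (norm x0) 0 + \<rho> (linf_norm u)" by simp
      next
        show "is_solution ?f u' x0 {0..<T} x" using Tx by (simp only: sol)
      qed (use Tx in blast)
      then show "\<exists>y. is_solution ?f u x0 {0..} y \<and> (\<forall>t\<in>{0..<T}. y t = x t)" by (simp only: sol)
    }
  qed
qed

end
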